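(* Let $(C^{m+1}, h=e^{-2\sigma}\bar h)$ be a conformally flat space, where $\bar h$ is a flat Riemannian metric and $\sigma$ is a smooth function (the conformal factor). Let $\varphi:(M^m,g)\longrightarrow (C^{m+1},h)$ be an isometric immersion of codimension one with mean curvature vector $\eta=H\xi$, where $\xi$ is a unit normal vector field, and let $A$ be the shape operator with respect to $\xi$. Then $\varphi$ is biharmonic if and only if $$\begin{cases} \Delta^M H-H |A|^{2}+H\{\Delta_h\sigma+(m-1)[\mathrm{Hess}_h(\sigma)(\xi,\xi)-(\xi\sigma)^2+|\mathrm{grad}_h\sigma|_h^{2}] \}=0,\\ 2A(\mathrm{grad}_g H) +\frac{m}{2}\, \mathrm{grad}_g H^2-2(m-1) H \,[\mathrm{grad}_g(\xi\sigma)-(\xi\sigma)\,\mathrm{grad}_g\sigma+ A(\mathrm{grad}_g \sigma)]=0. \end{cases}$$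
   Context: All manifolds, maps and tensor fields are smooth. A map $\varphi:(M,g)\to(N,h)$ between Riemannian manifolds is biharmonic if it is a critical point of the bienergy $\frac12\int_\Omega|\tau(\varphi)|^2$ for every compact $\Omega\subset M$, where $\tau(\varphi)=\mathrm{Trace}_g\nabla d\varphi$ is the tension field; equivalently $$\mathrm{Trace}_{g}(\nabla^{\varphi}\nabla^{\varphi}-\nabla^{\varphi}_{\nabla^{M}})\tau(\varphi)-\mathrm{Trace}_{g} R^{N}(d\varphi, \tau(\varphi))d\varphi=0,$$ with $R^{N}(X,Y)Z= [\nabla^{N}_{X},\nabla^{N}_{Y}]Z-\nabla^{N}_{[X,Y]}Z$. Conventions: the shape operator is $AX=-(\nabla_X\xi)^{\top}$, with $\nabla$ the Levi-Civita connection of $h$; $|A|^2=\mathrm{tr}(A^2)$; $H=\frac1m\mathrm{tr}\,A$. $\mathrm{grad}_h$, $\Delta_h$, $\mathrm{Hess}_h$ are the gradient, Laplacian and Hessian of $(C^{m+1},h)$; $\mathrm{grad}_g$ and $\Delta^M$ are the gradient and Laplacian of the hypersurface $(M,g)$. Laplacians are traces of Hessians. $\mathrm{grad}_g\sigma$ is the gradient of the restriction $\sigma\circ\varphi$, and $\xi\sigma$ is the derivative of $\sigma$ in the direction $\xi$, a function on $M$. *)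

theory Defs
  imports "HOL-Analysis.Analysis"
begin

section \<open>Riemannian calculus in coordinates\<close>

text \<open>
  A metric on an open subset of \<open>real ^ 'i\<close> is given by its Gram matrix \<open>G x\<close>, so that
  \<open>G x $ i $ j = G(\<partial>\<^sub>i, \<partial>\<^sub>j)\<close>; vectors and vector fields are given by their components.  A vector
  field along a map \<open>F\<close> assigns to \<open>x\<close> the components of a vector at the point \<open>F x\<close>.
\<close>

abbreviation fd :: "('a::real_normed_vector \<Rightarrow> 'b::real_normed_vector) \<Rightarrow> 'a \<Rightarrow> 'a \<Rightarrow> 'b" where
  "fd f x \<equiv> frechet_derivative f (at x)"

abbreviation pd :: "'i \<Rightarrow> (real ^ 'i::finite \<Rightarrow> 'b::real_normed_vector) \<Rightarrow> real ^ 'i \<Rightarrow> 'b" where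
  "pd i f x \<equiv> fd f x (axis i 1)"

text \<open>Only used for open \<open>S\<close>; \<open>diff_upto k\<close> says \<open>C\<^sup>k\<close>, all iterated derivatives being
  taken in arbitrary fixed directions.\<close>

fun diff_upto :: "nat \<Rightarrow> 'a set \<Rightarrow> ('a::real_normed_vector \<Rightarrow> 'b::real_normed_vector) \<Rightarrow> bool" where
  "diff_upto 0 S f \<longleftrightarrow> continuous_on S f"
| "diff_upto (Suc k) S f \<longleftrightarrow>
     (\<forall>x\<in>S. f differentiable (at x)) \<and> (\<forall>v. diff_upto k S (\<lambda>x. fd f x v))"

definition smooth_on :: "'a set \<Rightarrow> ('a::real_normed_vector \<Rightarrow> 'b::real_normed_vector) \<Rightarrow> bool" where
  "smooth_on S f \<longleftrightarrow> (\<forall>k. diff_upto k S f)"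

definition ip :: "real ^ 'i ^ 'i \<Rightarrow> real ^ 'i \<Rightarrow> real ^ 'i \<Rightarrow> real" where
  "ip G u v = (G *v u) \<bullet> v"

text \<open>\<open>Trace\<^sub>G B = G\<^sup>i\<^sup>j B(\<partial>\<^sub>i, \<partial>\<^sub>j)\<close> for a bilinear form \<open>B\<close>, possibly vector-valued.\<close>

definition gtrace :: "real ^ 'i::finite ^ 'i \<Rightarrow> (real ^ 'i \<Rightarrow> real ^ 'i \<Rightarrow> 'b::real_vector) \<Rightarrow> 'b" where
  "gtrace G B = (\<Sum>i\<in>UNIV. \<Sum>j\<in>UNIV. (matrix_inv G $ i $ j) *\<^sub>R B (axis i 1) (axis j 1))"

text \<open>Christoffel symbols \<open>\<Gamma>\<^sup>k\<^sub>i\<^sub>j = \<open>1/2\<close> G\<^sup>k\<^sup>l (\<partial>\<^sub>i G\<^sub>j\<^sub>l + \<partial>\<^sub>j G\<^sub>i\<^sub>l - \<partial>\<^sub>l G\<^sub>i\<^sub>j)\<close> of the Levi-Civita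
  connection, and the bilinear map \<open>(u, v) \<mapsto> \<Gamma>\<^sup>k\<^sub>i\<^sub>j u\<^sup>i v\<^sup>j\<close>.\<close>

definition christoffel :: "(real ^ 'i::finite \<Rightarrow> real ^ 'i ^ 'i) \<Rightarrow> real ^ 'i \<Rightarrow> 'i \<Rightarrow> 'i \<Rightarrow> 'i \<Rightarrow> real" where
  "christoffel G x k i j = (1/2) * (\<Sum>l\<in>UNIV. matrix_inv (G x) $ k $ l *
     (pd i (\<lambda>y. G y $ j $ l) x + pd j (\<lambda>y. G y $ i $ l) x - pd l (\<lambda>y. G y $ i $ j) x))"

definition Gam :: "(real ^ 'i::finite \<Rightarrow> real ^ 'i ^ 'i) \<Rightarrow> real ^ 'i \<Rightarrow> real ^ 'i \<Rightarrow> real ^ 'i \<Rightarrow> real ^ 'i" where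
  "Gam G x u v = (\<chi> k. \<Sum>i\<in>UNIV. \<Sum>j\<in>UNIV. christoffel G x k i j * u $ i * v $ j)"

definition nabla ::
  "(real ^ 'i::finite \<Rightarrow> real ^ 'i ^ 'i) \<Rightarrow> (real ^ 'i \<Rightarrow> real ^ 'i) \<Rightarrow> (real ^ 'i \<Rightarrow> real ^ 'i) \<Rightarrow> real ^ 'i \<Rightarrow> real ^ 'i" where
  "nabla G X Y x = fd Y x (X x) + Gam G x (X x) (Y x)"

definition lie_bracket ::
  "(real ^ 'i::finite \<Rightarrow> real ^ 'i) \<Rightarrow> (real ^ 'i \<Rightarrow> real ^ 'i) \<Rightarrow> real ^ 'i \<Rightarrow> real ^ 'i" where
  "lie_bracket X Y x = fd Y x (X x) - fd X x (Y x)"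

definition curvature ::
  "(real ^ 'i::finite \<Rightarrow> real ^ 'i ^ 'i) \<Rightarrow> (real ^ 'i \<Rightarrow> real ^ 'i) \<Rightarrow> (real ^ 'i \<Rightarrow> real ^ 'i) \<Rightarrow> (real ^ 'i \<Rightarrow> real ^ 'i)
    \<Rightarrow> real ^ 'i \<Rightarrow> real ^ 'i" where
  "curvature G X Y Z x =
     nabla G X (nabla G Y Z) x - nabla G Y (nabla G X Z) x - nabla G (lie_bracket X Y) Z x"

text \<open>\<open>R(u,v)w\<close> for single vectors at \<open>x\<close>: by tensoriality any extensions to vector fields
  may be used; we take those with constant components.\<close>

definition Riem ::
  "(real ^ 'i::finite \<Rightarrow> real ^ 'i ^ 'i) \<Rightarrow> real ^ 'i \<Rightarrow> real ^ 'i \<Rightarrow> real ^ 'i \<Rightarrow> real ^ 'i \<Rightarrow> real ^ 'i" where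
  "Riem G x u v w = curvature G (\<lambda>_. u) (\<lambda>_. v) (\<lambda>_. w) x"

definition grad :: "(real ^ 'i::finite \<Rightarrow> real ^ 'i ^ 'i) \<Rightarrow> (real ^ 'i \<Rightarrow> real) \<Rightarrow> real ^ 'i \<Rightarrow> real ^ 'i" where
  "grad G f x = matrix_inv (G x) *v (\<chi> i. pd i f x)"

definition Hess :: "(real ^ 'i::finite \<Rightarrow> real ^ 'i ^ 'i) \<Rightarrow> (real ^ 'i \<Rightarrow> real) \<Rightarrow> real ^ 'i \<Rightarrow> real ^ 'i \<Rightarrow> real ^ 'i \<Rightarrow> real" where
  "Hess G f x u v = fd (\<lambda>y. fd f y v) x u - fd f x (Gam G x u v)"

definition Laplace :: "(real ^ 'i::finite \<Rightarrow> real ^ 'i ^ 'i) \<Rightarrow> (real ^ 'i \<Rightarrow> real) \<Rightarrow> real ^ 'i \<Rightarrow> real" where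
  "Laplace G f x = gtrace (G x) (Hess G f x)"

text \<open>In the sequel \<open>G\<close> is the metric of the domain and \<open>K\<close> that of the target of
  \<open>F :: real ^ 'm \<Rightarrow> real ^ 'n\<close>.  \<open>nabla_along K F u V x\<close> is \<open>\<nabla>\<^sup>F\<^sub>u V\<close> at \<open>x\<close>, for the connection
  induced on the pull-back of the tangent bundle along \<open>F\<close>.\<close>

definition nabla_along ::
  "(real ^ 'n::finite \<Rightarrow> real ^ 'n ^ 'n) \<Rightarrow> (real ^ 'm::finite \<Rightarrow> real ^ 'n) \<Rightarrow> real ^ 'm \<Rightarrow> (real ^ 'm \<Rightarrow> real ^ 'n)
    \<Rightarrow> real ^ 'm \<Rightarrow> real ^ 'n" where
  "nabla_along K F u V x = fd V x u + Gam K (F x) (fd F x u) (V x)"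

text \<open>\<open>(\<nabla>dF)(u,v) = \<nabla>\<^sup>F\<^sub>u (dF v) - dF(\<nabla>\<^sub>u v)\<close>, with \<open>u\<close> and \<open>v\<close> extended by constant
  components, for which \<open>\<nabla>\<^sub>u v = \<Gamma>(u,v)\<close>.\<close>

definition second_fund ::
  "(real ^ 'm::finite \<Rightarrow> real ^ 'm ^ 'm) \<Rightarrow> (real ^ 'n::finite \<Rightarrow> real ^ 'n ^ 'n) \<Rightarrow> (real ^ 'm \<Rightarrow> real ^ 'n)
    \<Rightarrow> real ^ 'm \<Rightarrow> real ^ 'm \<Rightarrow> real ^ 'm \<Rightarrow> real ^ 'n" where
  "second_fund G K F x u v = nabla_along K F u (\<lambda>y. fd F y v) x - fd F x (Gam G x u v)"

definition tension ::
  "(real ^ 'm::finite \<Rightarrow> real ^ 'm ^ 'm) \<Rightarrow> (real ^ 'n::finite \<Rightarrow> real ^ 'n ^ 'n) \<Rightarrow> (real ^ 'm \<Rightarrow> real ^ 'n)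
    \<Rightarrow> real ^ 'm \<Rightarrow> real ^ 'n" where
  "tension G K F x = gtrace (G x) (second_fund G K F x)"

text \<open>The Euler-Lagrange expression
  \<open>Trace\<^sub>G (\<nabla>\<^sup>F \<nabla>\<^sup>F - \<nabla>\<^sup>F\<^sub>\<nabla>) \<tau> - Trace\<^sub>G R(dF, \<tau>) dF\<close> of the bienergy.\<close>

definition bitension ::
  "(real ^ 'm::finite \<Rightarrow> real ^ 'm ^ 'm) \<Rightarrow> (real ^ 'n::finite \<Rightarrow> real ^ 'n ^ 'n) \<Rightarrow> (real ^ 'm \<Rightarrow> real ^ 'n)
    \<Rightarrow> real ^ 'm \<Rightarrow> real ^ 'n" where
  "bitension G K F x =
     gtrace (G x) (\<lambda>u v. nabla_along K F u (\<lambda>y. nabla_along K F v (tension G K F) y) x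
                         - nabla_along K F (Gam G x u v) (tension G K F) x)
     - gtrace (G x) (\<lambda>u v. Riem K (F x) (fd F x u) (tension G K F x) (fd F x v))"

text \<open>The tangential part \<open>V\<^sup>\<top>\<close> of a vector \<open>V\<close> at \<open>F x\<close>, as a vector \<open>w\<close> at \<open>x\<close>: the
  remainder \<open>V - dF w\<close> is orthogonal to the image of \<open>dF\<close>.\<close>

definition tangential ::
  "(real ^ 'n::finite \<Rightarrow> real ^ 'n ^ 'n) \<Rightarrow> (real ^ 'm::finite \<Rightarrow> real ^ 'n) \<Rightarrow> real ^ 'm \<Rightarrow> real ^ 'n \<Rightarrow> real ^ 'm" where
  "tangential K F x V = (THE w. \<forall>u. ip (K (F x)) (V - fd F x w) (fd F x u) = 0)"

definition shape ::
  "(real ^ 'n::finite \<Rightarrow> real ^ 'n ^ 'n) \<Rightarrow> (real ^ 'm::finite \<Rightarrow> real ^ 'n) \<Rightarrow> (real ^ 'm \<Rightarrow> real ^ 'n)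
    \<Rightarrow> real ^ 'm \<Rightarrow> real ^ 'm \<Rightarrow> real ^ 'm" where
  "shape K F \<xi> x u = - tangential K F x (nabla_along K F u \<xi> x)"

definition mean_curv ::
  "(real ^ 'n::finite \<Rightarrow> real ^ 'n ^ 'n) \<Rightarrow> (real ^ 'm::finite \<Rightarrow> real ^ 'n) \<Rightarrow> (real ^ 'm \<Rightarrow> real ^ 'n)
    \<Rightarrow> real ^ 'm \<Rightarrow> real" where
  "mean_curv K F \<xi> x = trace (matrix (shape K F \<xi> x)) / real CARD('m)"

definition shape_norm2 ::
  "(real ^ 'n::finite \<Rightarrow> real ^ 'n ^ 'n) \<Rightarrow> (real ^ 'm::finite \<Rightarrow> real ^ 'n) \<Rightarrow> (real ^ 'm \<Rightarrow> real ^ 'n)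
    \<Rightarrow> real ^ 'm \<Rightarrow> real" where
  "shape_norm2 K F \<xi> x = trace (matrix (shape K F \<xi> x) ** matrix (shape K F \<xi> x))"


section \<open>Manifolds\<close>

text \<open>A chart is its open domain together with its coordinate map, which is relevant on the
  domain only.  A manifold is given by a smooth atlas; its underlying set is \<open>carrier\<close>.\<close>

type_synonym ('p, 'i) chart = "'p set \<times> ('p \<Rightarrow> real ^ 'i)"

abbreviation cdom :: "('p, 'i) chart \<Rightarrow> 'p set" where "cdom c \<equiv> fst c"

abbreviation cmap :: "('p, 'i) chart \<Rightarrow> 'p \<Rightarrow> real ^ 'i" where "cmap c \<equiv> snd c"

definition cinv :: "('p, 'i) chart \<Rightarrow> real ^ 'i \<Rightarrow> 'p" where
  "cinv c = inv_into (cdom c) (cmap c)"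

definition carrier :: "('p, 'i) chart set \<Rightarrow> 'p set" where
  "carrier A = (\<Union>c\<in>A. cdom c)"

definition smooth_manifold ::
  "('p::{t2_space,second_countable_topology}, 'i::finite) chart set \<Rightarrow> bool" where
  "smooth_manifold A \<longleftrightarrow>
     (\<forall>c\<in>A. open (cdom c) \<and> open (cmap c ` cdom c) \<and>
            homeomorphism (cdom c) (cmap c ` cdom c) (cmap c) (cinv c)) \<and>
     (\<forall>c\<in>A. \<forall>c'\<in>A. smooth_on (cmap c ` (cdom c \<inter> cdom c')) (cmap c' \<circ> cinv c))"

text \<open>Differential at \<open>p\<close> of the change of coordinates from \<open>c\<close> to \<open>c'\<close>.\<close>

definition jac :: "('p, 'i::finite) chart \<Rightarrow> ('p, 'i) chart \<Rightarrow> 'p \<Rightarrow> real ^ 'i \<Rightarrow> real ^ 'i" where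
  "jac c c' p = fd (cmap c' \<circ> cinv c) (cmap c p)"

text \<open>Coordinate expressions of functions (and of component functions) and of maps.\<close>

definition rep :: "('p, 'i::finite) chart \<Rightarrow> ('p \<Rightarrow> 'b) \<Rightarrow> real ^ 'i \<Rightarrow> 'b" where
  "rep c f = f \<circ> cinv c"

definition map_rep ::
  "('p, 'm::finite) chart \<Rightarrow> ('q, 'n::finite) chart \<Rightarrow> ('p \<Rightarrow> 'q) \<Rightarrow> real ^ 'm \<Rightarrow> real ^ 'n" where
  "map_rep c d \<phi> = cmap d \<circ> \<phi> \<circ> cinv c"

definition smooth_fun :: "('p, 'i::finite) chart set \<Rightarrow> ('p \<Rightarrow> real) \<Rightarrow> bool" where
  "smooth_fun A f \<longleftrightarrow> (\<forall>c\<in>A. smooth_on (cmap c ` cdom c) (rep c f))"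

definition smooth_map ::
  "('p::topological_space, 'm::finite) chart set \<Rightarrow> ('q::topological_space, 'n::finite) chart set
    \<Rightarrow> ('p \<Rightarrow> 'q) \<Rightarrow> bool" where
  "smooth_map A B \<phi> \<longleftrightarrow> \<phi> ` carrier A \<subseteq> carrier B \<and> continuous_on (carrier A) \<phi> \<and>
     (\<forall>c\<in>A. \<forall>d\<in>B. smooth_on (cmap c ` {p \<in> cdom c. \<phi> p \<in> cdom d}) (map_rep c d \<phi>))"

text \<open>Tensor fields are given by their components in each chart of the atlas, subject to the
  transformation law.  For a metric \<open>g\<close>, \<open>g c p\<close> is the Gram matrix at \<open>p\<close> in the chart \<open>c\<close>.\<close>

type_synonym ('p, 'i) metric = "('p, 'i) chart \<Rightarrow> 'p \<Rightarrow> real ^ 'i ^ 'i"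

definition riemannian_metric :: "('p, 'i::finite) chart set \<Rightarrow> ('p, 'i) metric \<Rightarrow> bool" where
  "riemannian_metric A g \<longleftrightarrow>
     (\<forall>c\<in>A. smooth_on (cmap c ` cdom c) (rep c (g c))) \<and>
     (\<forall>c\<in>A. \<forall>p\<in>cdom c. transpose (g c p) = g c p \<and> (\<forall>u. u \<noteq> 0 \<longrightarrow> ip (g c p) u u > 0)) \<and>
     (\<forall>c\<in>A. \<forall>c'\<in>A. \<forall>p\<in>cdom c \<inter> cdom c'. \<forall>u v.
        ip (g c' p) (jac c c' p u) (jac c c' p v) = ip (g c p) u v)"

definition flat_metric :: "('p, 'i::finite) chart set \<Rightarrow> ('p, 'i) metric \<Rightarrow> bool" where
  "flat_metric A g \<longleftrightarrow> riemannian_metric A g \<and>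
     (\<forall>c\<in>A. \<forall>p\<in>cdom c. \<forall>u v w. Riem (rep c (g c)) (cmap c p) u v w = 0)"

definition isometric_immersion ::
  "('p::topological_space, 'm::finite) chart set \<Rightarrow> ('p, 'm) metric
    \<Rightarrow> ('q::topological_space, 'n::finite) chart set \<Rightarrow> ('q, 'n) metric \<Rightarrow> ('p \<Rightarrow> 'q) \<Rightarrow> bool" where
  "isometric_immersion A g B h \<phi> \<longleftrightarrow> smooth_map A B \<phi> \<and>
     (\<forall>c\<in>A. \<forall>d\<in>B. \<forall>p\<in>cdom c. \<phi> p \<in> cdom d \<longrightarrow>
        inj (fd (map_rep c d \<phi>) (cmap c p)) \<and>
        (\<forall>u v. ip (h d (\<phi> p)) (fd (map_rep c d \<phi>) (cmap c p) u) (fd (map_rep c d \<phi>) (cmap c p) v)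
               = ip (g c p) u v))"

text \<open>For a vector field \<open>\<xi>\<close> along \<open>\<phi>\<close>, \<open>\<xi> d p\<close> are the components of \<open>\<xi>\<^sub>p \<in> T\<^bsub>\<phi>(p)\<^esub>\<close> in the chart \<open>d\<close>
  of the target.\<close>

definition vector_field_along ::
  "('p, 'm::finite) chart set \<Rightarrow> ('q, 'n::finite) chart set \<Rightarrow> ('p \<Rightarrow> 'q)
    \<Rightarrow> (('q, 'n) chart \<Rightarrow> 'p \<Rightarrow> real ^ 'n) \<Rightarrow> bool" where
  "vector_field_along A B \<phi> \<xi> \<longleftrightarrow>
     (\<forall>c\<in>A. \<forall>d\<in>B. smooth_on (cmap c ` {p \<in> cdom c. \<phi> p \<in> cdom d}) (rep c (\<xi> d))) \<and>
     (\<forall>p\<in>carrier A. \<forall>d\<in>B. \<forall>d'\<in>B. \<phi> p \<in> cdom d \<inter> cdom d' \<longrightarrow>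
        \<xi> d' p = jac d d' (\<phi> p) (\<xi> d p))"

definition unit_normal_field ::
  "('p, 'm::finite) chart set \<Rightarrow> ('q, 'n::finite) chart set \<Rightarrow> ('q, 'n) metric \<Rightarrow> ('p \<Rightarrow> 'q)
    \<Rightarrow> (('q, 'n) chart \<Rightarrow> 'p \<Rightarrow> real ^ 'n) \<Rightarrow> bool" where
  "unit_normal_field A B h \<phi> \<xi> \<longleftrightarrow> vector_field_along A B \<phi> \<xi> \<and>
     (\<forall>c\<in>A. \<forall>d\<in>B. \<forall>p\<in>cdom c. \<phi> p \<in> cdom d \<longrightarrow>
        ip (h d (\<phi> p)) (\<xi> d p) (\<xi> d p) = 1 \<and>
        (\<forall>u. ip (h d (\<phi> p)) (\<xi> d p) (fd (map_rep c d \<phi>) (cmap c p) u) = 0))"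

definition biharmonic ::
  "('p, 'm::finite) chart set \<Rightarrow> ('p, 'm) metric \<Rightarrow> ('q, 'n::finite) chart set \<Rightarrow> ('q, 'n) metric
    \<Rightarrow> ('p \<Rightarrow> 'q) \<Rightarrow> bool" where
  "biharmonic A g B h \<phi> \<longleftrightarrow>
     (\<forall>c\<in>A. \<forall>d\<in>B. \<forall>p\<in>cdom c. \<phi> p \<in> cdom d \<longrightarrow>
        bitension (rep c (g c)) (rep d (h d)) (map_rep c d \<phi>) (cmap c p) = 0)"

end

theory Submission
  imports Defs
begin

text \<open>
  Both sides are pointwise conditions in charts, and they are shown to be equivalent at every point.
  With \<open>f = tr A = m H\<close> the tension field is \<open>f \<xi>\<close>, and the formulas of Gauss and Weingarten
  give the bitension as
  \<open>(\<Delta>f - f |A|\<^sup>2) \<xi> - 2 dF(A grad f) - f dF(div A) - f Trace R(dF, \<xi>) dF\<close>.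
  The divergence of \<open>A\<close> is found by tracing the Codazzi equation.
  As \<open>exp (2 \<sigma>) h\<close> is flat, the curvature of \<open>h\<close> is determined by the tensor
  \<open>P = Hess \<sigma> - d\<sigma> \<otimes> d\<sigma> + (1/2) |grad \<sigma>|\<^sup>2 h\<close>:
  \<open>R(u,v)w = P(v,w) u - P(u,w) v + h(v,w) P u - h(u,w) P v\<close>.
  The two equations of the theorem are the \<open>\<xi>\<close>-component and the tangential component, divided
  by \<open>m\<close> and \<open>-m\<close>.
\<close>

section \<open>Smooth functions\<close>

text \<open>Coordinate frames are not orthonormal and are not adapted to the hypersurface. Vectors
  are therefore compared through their inner products with the image of \<open>dF\<close> and with
  \<xi>, and connections are recognised by symmetry and compatibility with the metric. Flatness is
  available only as vanishing curvature in the given charts, hence the comparison of the curvatures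
  of two conformal metrics instead of a passage to flat coordinates. The constants of the theorem
  arise as follows. The curvature trace in the normal direction is the trace of P over the tangent
  space plus m P(\<xi>,\<xi>), that is, the full trace of P plus (m-1) P(\<xi>,\<xi>). The full
  trace and the last term each carry (m-1)/2 times |grad \<sigma>|^2. In the tangential direction,
  div A and the curvature trace each contribute m-1 copies of P(\<xi>, dF w), which is the inner
  product of w with the square bracket of the second equation; this explains 2(m-1).\<close>

lemma fd_cong:
  assumes "open S" "x \<in> S" "\<And>y. y \<in> S \<Longrightarrow> f y = g y"
  shows "fd f x = fd g x"
proof -
  \<comment> \<open>Both functions have the same set of derivatives, so the choice operator in
    \<open>frechet_derivative\<close> returns the same value even where that set is empty.\<close>
  have "(f has_derivative D) (at x) \<longleftrightarrow> (g has_derivative D) (at x)" for D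
    using has_derivative_transform_within_open[where f=f and g=g and s=S]
      has_derivative_transform_within_open[where f=g and g=f and s=S] assms
    by metis
  then show ?thesis
    unfolding frechet_derivative_def by simp
qed

lemma fdI: "(f has_derivative D) (at x) \<Longrightarrow> fd f x = D"
  by (simp add: frechet_derivative_at[symmetric])

section \<open>Closure properties of finite differentiability, order by order\<close>

lemma diff_upto_cong:
  assumes "open S" "\<And>x. x \<in> S \<Longrightarrow> f x = g x" "diff_upto k S f"
  shows "diff_upto k S g"
  using assms(2,3)
proof (induction k arbitrary: f g)
  case 0
  then show ?case by (simp cong: continuous_on_cong)
next
  case (Suc k)
  have "g differentiable (at x)" if "x \<in> S" for x
    using Suc.prems that has_derivative_transform_within_open[where f=f and g=g and s=S] assms(1)
    by (metis diff_upto.simps(2) differentiable_def)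
  moreover have "diff_upto k S (\<lambda>x. fd g x v)" for v
    using Suc.IH[of "\<lambda>x. fd f x v" "\<lambda>x. fd g x v"] Suc.prems
      fd_cong[OF assms(1), of _ f g] by simp
  ultimately show ?case by simp
qed

lemma diff_upto_SucD: "diff_upto (Suc k) S f \<Longrightarrow> diff_upto k S f"
proof (induction k arbitrary: f)
  case 0
  then show ?case
    by (auto simp: continuous_on_eq_continuous_at continuous_at_imp_continuous_on
        intro!: continuous_at_imp_continuous_on differentiable_imp_continuous_within)
next
  case (Suc k)
  then show ?case
    by (metis diff_upto.simps(2))
qed

lemma diff_upto_subset: "diff_upto k S f \<Longrightarrow> T \<subseteq> S \<Longrightarrow> diff_upto k T f"
  by (induction k arbitrary: f) (auto intro: continuous_on_subset)

lemma diff_upto_const: "diff_upto k S (\<lambda>_. c)"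
  by (induction k arbitrary: c) auto

lemma diff_upto_linear:
  assumes "bounded_linear L"
  shows "diff_upto k S L"
proof (cases k)
  case 0
  then show ?thesis
    using assms by (simp add: linear_continuous_on)
next
  case (Suc j)
  have "fd L x = L" for x
    by (rule fdI) (rule bounded_linear_imp_has_derivative[OF assms])
  then show ?thesis
    using Suc bounded_linear_imp_differentiable[OF assms] by (simp add: diff_upto_const)
qed

lemma diff_upto_add:
  assumes "open S" "diff_upto k S f" "diff_upto k S g"
  shows "diff_upto k S (\<lambda>x. f x + g x)"
  using assms(2,3)
proof (induction k arbitrary: f g)
  case 0
  then show ?case by (auto intro: continuous_on_add)
next
  case (Suc k)
  have *: "((\<lambda>x. f x + g x) has_derivative (\<lambda>v. fd f x v + fd g x v)) (at x)" if "x \<in> S" for x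
    using Suc.prems that by (intro has_derivative_add) (auto simp: frechet_derivative_works)
  have "diff_upto k S (\<lambda>x. fd (\<lambda>x. f x + g x) x v)" for v
  proof (rule diff_upto_cong[OF assms(1)])
    show "diff_upto k S (\<lambda>x. fd f x v + fd g x v)"
      using Suc.prems by (intro Suc.IH) auto
  qed (simp add: fdI[OF *])
  then show ?case
    using * by (auto simp: differentiable_def)
qed

lemma diff_upto_sum:
  assumes "open S" "\<And>i. i \<in> I \<Longrightarrow> diff_upto k S (f i)"
  shows "diff_upto k S (\<lambda>x. \<Sum>i\<in>I. f i x)"
  using assms(2)
  by (induction I rule: infinite_finite_induct)
    (auto intro: diff_upto_const diff_upto_add[OF assms(1)])

text \<open>The product rule yields two products of the same kind with one factor differentiated, so
  the induction runs over all pairs of factors. An abstract product covers multiplication, scaling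
  and the inner product at once.\<close>

lemma diff_upto_bilinear:
  assumes "open S" "bounded_bilinear p" "diff_upto k S f" "diff_upto k S g"
  shows "diff_upto k S (\<lambda>x. p (f x) (g x))"
  using assms(3,4)
proof (induction k arbitrary: f g)
  case 0
  then show ?case
    using bounded_bilinear.continuous_on[OF assms(2)] by auto
next
  case (Suc k)
  have *: "((\<lambda>x. p (f x) (g x)) has_derivative (\<lambda>v. p (f x) (fd g x v) + p (fd f x v) (g x))) (at x)"
    if "x \<in> S" for x
    using Suc.prems that
    by (intro bounded_bilinear.FDERIV[OF assms(2)]) (auto simp: frechet_derivative_works)
  have "diff_upto k S (\<lambda>x. fd (\<lambda>x. p (f x) (g x)) x v)" for v
  proof (rule diff_upto_cong[OF assms(1)])
    show "diff_upto k S (\<lambda>x. p (f x) (fd g x v) + p (fd f x v) (g x))"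
      using Suc.prems diff_upto_SucD[OF Suc.prems(1)] diff_upto_SucD[OF Suc.prems(2)]
      by (intro diff_upto_add[OF assms(1)] Suc.IH) auto
  qed (simp add: fdI[OF *])
  then show ?case
    using * by (auto simp: differentiable_def)
qed

lemma linear_expand_euclidean:
  fixes L :: "'a::euclidean_space \<Rightarrow> 'b::real_vector"
  assumes "linear L"
  shows "L v = (\<Sum>b\<in>Basis. (v \<bullet> b) *\<^sub>R L b)"
proof -
  have "L v = L (\<Sum>b\<in>Basis. (v \<bullet> b) *\<^sub>R b)"
    by (simp add: euclidean_representation)
  then show ?thesis
    by (simp add: linear_sum[OF assms] linear_scale[OF assms])
qed

text \<open>In the chain rule the outer derivative is taken in a direction that moves with
  \<open>x\<close>, whereas \<open>diff_upto\<close> speaks of fixed directions only. Expanding the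
  direction over \<open>Basis\<close> leaves fixed directions with smooth coefficients.\<close>

lemma diff_upto_compose:
  fixes g :: "'a::real_normed_vector \<Rightarrow> 'b::euclidean_space"
  assumes "open S" "g ` S \<subseteq> T" "diff_upto k T f" "diff_upto k S g"
  shows "diff_upto k S (\<lambda>x. f (g x))"
  using assms(3,4)
proof (induction k arbitrary: f)
  case 0
  then show ?case
    using assms(2) by (auto intro: continuous_on_compose2)
next
  case (Suc k)
  have df: "(f has_derivative fd f (g x)) (at (g x))" if "x \<in> S" for x
    using Suc.prems that assms(2) frechet_derivative_works[of f] by auto
  have *: "((\<lambda>x. f (g x)) has_derivative (\<lambda>v. fd f (g x) (fd g x v))) (at x)" if "x \<in> S" for x
    using Suc.prems that assms(2)
    by (intro has_derivative_compose[of g _ x UNIV f, OF _ df]) (auto simp: frechet_derivative_works)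
  have "diff_upto k S (\<lambda>x. fd (\<lambda>x. f (g x)) x v)" for v
  proof (rule diff_upto_cong[OF assms(1)])
    show "diff_upto k S (\<lambda>x. \<Sum>b\<in>Basis. (fd g x v \<bullet> b) *\<^sub>R fd f (g x) b)"
      using Suc.prems diff_upto_SucD[OF Suc.prems(2)]
      by (intro diff_upto_sum[OF assms(1)] diff_upto_bilinear[OF assms(1) bounded_bilinear_scaleR]
          diff_upto_bilinear[OF assms(1) bounded_bilinear_inner] diff_upto_const Suc.IH) auto
    show "(\<Sum>b\<in>Basis. (fd g x v \<bullet> b) *\<^sub>R fd f (g x) b) = fd (\<lambda>x. f (g x)) x v" if "x \<in> S" for x
      using linear_expand_euclidean[of "fd f (g x)" "fd g x v"] fdI[OF *[OF that]]
        has_derivative_linear[OF df[OF that]] by simp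
  qed
  then show ?case
    using * by (auto simp: differentiable_def)
qed

text \<open>The derivative of the reciprocal contains only the reciprocal itself and the derivative
  of \<open>f\<close>, so the induction hypothesis applies to every factor.\<close>

lemma diff_upto_inverse:
  fixes f :: "'a::real_normed_vector \<Rightarrow> real"
  assumes "open S" "diff_upto k S f" "\<And>x. x \<in> S \<Longrightarrow> f x \<noteq> 0"
  shows "diff_upto k S (\<lambda>x. inverse (f x))"
  using assms(2)
proof (induction k)
  case 0
  then show ?case
    using assms(3) by (auto intro: continuous_on_inverse)
next
  case (Suc k)
  have *: "((\<lambda>x. inverse (f x)) has_derivative (\<lambda>v. - (inverse (f x) * fd f x v * inverse (f x)))) (at x)"
    if "x \<in> S" for x
    using Suc.prems that assms(3)
    by (intro Deriv.has_derivative_inverse) (auto simp: frechet_derivative_works)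
  have "diff_upto k S (\<lambda>x. fd (\<lambda>x. inverse (f x)) x v)" for v
  proof (rule diff_upto_cong[OF assms(1)])
    show "diff_upto k S (\<lambda>x. (- 1) * (inverse (f x) * fd f x v * inverse (f x)))"
      using Suc.prems diff_upto_SucD[OF Suc.prems]
      by (intro diff_upto_bilinear[OF assms(1) bounded_bilinear_mult] diff_upto_const Suc.IH) auto
  qed (simp add: fdI[OF *])
  then show ?case
    using * by (auto simp: differentiable_def)
qed

section \<open>Closure properties of smooth functions\<close>

lemma smooth_on_cong:
  "open S \<Longrightarrow> (\<And>x. x \<in> S \<Longrightarrow> f x = g x) \<Longrightarrow> smooth_on S f \<Longrightarrow> smooth_on S g"
  unfolding smooth_on_def using diff_upto_cong by blast

lemma smooth_on_subset: "smooth_on S f \<Longrightarrow> T \<subseteq> S \<Longrightarrow> smooth_on T f"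
  unfolding smooth_on_def using diff_upto_subset by blast

lemma smooth_on_const: "smooth_on S (\<lambda>_. c)"
  by (simp add: smooth_on_def diff_upto_const)

lemma smooth_on_linear: "bounded_linear L \<Longrightarrow> smooth_on S L"
  by (simp add: smooth_on_def diff_upto_linear)

lemma smooth_on_id: "smooth_on S (\<lambda>x. x)"
  by (rule smooth_on_linear) (rule bounded_linear_ident)

lemma smooth_on_exp: "smooth_on S (exp :: real \<Rightarrow> real)"
proof -
  have *: "fd exp x v = exp x * v" for x v :: real
    by (subst fdI[of exp "\<lambda>v. exp x * v"]) (auto intro!: derivative_eq_intros)
  have "diff_upto k UNIV (exp :: real \<Rightarrow> real)" for k
  proof (induction k)
    case 0
    then show ?case by (simp add: continuous_on_exp)
  next
    case (Suc k)
    have "exp differentiable (at x)" for x :: real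
      unfolding differentiable_def by (rule exI, rule DERIV_exp[unfolded has_field_derivative_def])
    moreover have "diff_upto k UNIV (\<lambda>x :: real. exp x * v)" for v
      by (rule diff_upto_bilinear[OF open_UNIV bounded_bilinear_mult Suc diff_upto_const])
    ultimately show ?case
      by (simp add: *)
  qed
  then show ?thesis
    unfolding smooth_on_def using diff_upto_subset by blast
qed

lemma smooth_on_add:
  "open S \<Longrightarrow> smooth_on S f \<Longrightarrow> smooth_on S g \<Longrightarrow> smooth_on S (\<lambda>x. f x + g x)"
  by (simp add: smooth_on_def diff_upto_add)

lemma smooth_on_sum:
  "open S \<Longrightarrow> (\<And>i. i \<in> I \<Longrightarrow> smooth_on S (f i)) \<Longrightarrow> smooth_on S (\<lambda>x. \<Sum>i\<in>I. f i x)"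
  by (simp add: smooth_on_def diff_upto_sum)

lemma smooth_on_bilinear:
  "bounded_bilinear p \<Longrightarrow> open S \<Longrightarrow> smooth_on S f \<Longrightarrow> smooth_on S g \<Longrightarrow> smooth_on S (\<lambda>x. p (f x) (g x))"
  by (simp add: smooth_on_def diff_upto_bilinear)

lemmas smooth_on_mult = smooth_on_bilinear[OF bounded_bilinear_mult]
lemmas smooth_on_scaleR = smooth_on_bilinear[OF bounded_bilinear_scaleR]
lemmas smooth_on_inner = smooth_on_bilinear[OF bounded_bilinear_inner]

lemma smooth_on_compose:
  fixes g :: "'a::real_normed_vector \<Rightarrow> 'b::euclidean_space"
  shows "open S \<Longrightarrow> g ` S \<subseteq> T \<Longrightarrow> smooth_on T f \<Longrightarrow> smooth_on S g \<Longrightarrow> smooth_on S (\<lambda>x. f (g x))"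
  unfolding smooth_on_def using diff_upto_compose by blast

lemma smooth_on_bounded_linear:
  fixes g :: "'a::real_normed_vector \<Rightarrow> 'b::euclidean_space"
  shows "bounded_linear L \<Longrightarrow> open S \<Longrightarrow> smooth_on S g \<Longrightarrow> smooth_on S (\<lambda>x. L (g x))"
  using smooth_on_compose[of S g UNIV L] smooth_on_linear[of L UNIV] by simp

lemma smooth_on_minus:
  assumes "open S" "smooth_on S f"
  shows "smooth_on S (\<lambda>x. - f x)"
  using smooth_on_scaleR[OF assms(1) smooth_on_const[of S "-1"] assms(2)] by simp

lemma smooth_on_diff:
  assumes "open S" "smooth_on S f" "smooth_on S g"
  shows "smooth_on S (\<lambda>x. f x - g x)"
  using smooth_on_add[OF assms(1,2) smooth_on_minus[OF assms(1,3)]] by simp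

lemma smooth_on_vec_nth:
  fixes f :: "'a::real_normed_vector \<Rightarrow> 'b::euclidean_space ^ 'i"
  shows "open S \<Longrightarrow> smooth_on S f \<Longrightarrow> smooth_on S (\<lambda>x. f x $ i)"
  by (rule smooth_on_bounded_linear[OF bounded_linear_vec_nth])

lemma smooth_on_inverse:
  fixes f :: "'a::real_normed_vector \<Rightarrow> real"
  shows "open S \<Longrightarrow> smooth_on S f \<Longrightarrow> (\<And>x. x \<in> S \<Longrightarrow> f x \<noteq> 0) \<Longrightarrow> smooth_on S (\<lambda>x. inverse (f x))"
  by (simp add: smooth_on_def diff_upto_inverse)

lemma smooth_on_divide:
  fixes f g :: "'a::real_normed_vector \<Rightarrow> real"
  assumes "open S" "smooth_on S f" "smooth_on S g" "\<And>x. x \<in> S \<Longrightarrow> g x \<noteq> 0"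
  shows "smooth_on S (\<lambda>x. f x / g x)"
  unfolding divide_inverse
  using assms by (intro smooth_on_mult smooth_on_inverse) auto

lemma smooth_on_prod:
  fixes f :: "'i \<Rightarrow> 'a::real_normed_vector \<Rightarrow> real"
  assumes "open S" "\<And>i. i \<in> I \<Longrightarrow> smooth_on S (f i)"
  shows "smooth_on S (\<lambda>x. \<Prod>i\<in>I. f i x)"
  using assms(2)
  by (induction I rule: infinite_finite_induct)
    (auto intro: smooth_on_const smooth_on_mult[OF assms(1)])

lemma smooth_on_componentwise:
  fixes f :: "'a::real_normed_vector \<Rightarrow> real ^ 'i::finite"
  assumes "open S" "\<And>i. smooth_on S (\<lambda>x. f x $ i)"
  shows "smooth_on S f"
proof -
  have "smooth_on S (\<lambda>x. \<Sum>i\<in>UNIV. (f x $ i) *\<^sub>R (axis i 1 :: real ^ 'i))"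
    by (intro smooth_on_sum smooth_on_scaleR smooth_on_const assms)
  moreover have "(\<lambda>x. \<Sum>i\<in>UNIV. (f x $ i) *\<^sub>R (axis i 1 :: real ^ 'i)) = f"
    by (auto simp: vec_eq_iff axis_def if_distrib cong: if_cong)
  ultimately show ?thesis by simp
qed

lemma smooth_on_differentiable: "smooth_on S f \<Longrightarrow> x \<in> S \<Longrightarrow> f differentiable (at x)"
  unfolding smooth_on_def by (metis diff_upto.simps(2))

lemma smooth_on_has_derivative: "smooth_on S f \<Longrightarrow> x \<in> S \<Longrightarrow> (f has_derivative fd f x) (at x)"
  using smooth_on_differentiable frechet_derivative_works by blast

lemma smooth_on_linear_fd: "smooth_on S f \<Longrightarrow> x \<in> S \<Longrightarrow> linear (fd f x)"
  by (rule linear_frechet_derivative[OF smooth_on_differentiable])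

lemma smooth_on_continuous_on: "smooth_on S f \<Longrightarrow> continuous_on S f"
  unfolding smooth_on_def by (metis diff_upto.simps(1))

lemma smooth_on_fd_const: "smooth_on S f \<Longrightarrow> smooth_on S (\<lambda>x. fd f x v)"
  unfolding smooth_on_def by (metis diff_upto.simps(2))

text \<open>Needed for fields along a map, where both the base point and the direction of
  differentiation move.\<close>

lemma smooth_on_fd:
  fixes f :: "'b::euclidean_space \<Rightarrow> 'c::real_normed_vector"
    and F :: "'a::real_normed_vector \<Rightarrow> 'b"
  assumes "open S" "F ` S \<subseteq> T" "smooth_on T f" "smooth_on S F" "smooth_on S V"
  shows "smooth_on S (\<lambda>x. fd f (F x) (V x))"
proof (rule smooth_on_cong[OF assms(1)])
  show "smooth_on S (\<lambda>x. \<Sum>b\<in>Basis. (V x \<bullet> b) *\<^sub>R fd f (F x) b)"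
    by (intro smooth_on_sum smooth_on_scaleR smooth_on_inner smooth_on_const assms
        smooth_on_compose[OF assms(1,2) _ assms(4)] smooth_on_fd_const)
  show "(\<Sum>b\<in>Basis. (V x \<bullet> b) *\<^sub>R fd f (F x) b) = fd f (F x) (V x)" if "x \<in> S" for x
    using linear_expand_euclidean[OF smooth_on_linear_fd[OF assms(3)], of "F x" "V x"] that assms(2)
    by auto
qed

section \<open>Differentiation rules for smooth functions\<close>

lemma fd_compose:
  assumes "smooth_on T f" "smooth_on S g" "x \<in> S" "g x \<in> T"
  shows "fd (\<lambda>x. f (g x)) x v = fd f (g x) (fd g x v)"
  using fdI[OF has_derivative_compose[of g _ x UNIV f, OF smooth_on_has_derivative[OF assms(2,3)]
        smooth_on_has_derivative[OF assms(1,4)]]] by simp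

lemma fd_add:
  assumes "smooth_on S f" "smooth_on S g" "x \<in> S"
  shows "fd (\<lambda>x. f x + g x) x v = fd f x v + fd g x v"
  using fdI[OF has_derivative_add[OF assms(1,2)[THEN smooth_on_has_derivative, OF assms(3)]]]
  by simp

lemma fd_diff:
  assumes "smooth_on S f" "smooth_on S g" "x \<in> S"
  shows "fd (\<lambda>x. f x - g x) x v = fd f x v - fd g x v"
  using fdI[OF has_derivative_diff[OF assms(1,2)[THEN smooth_on_has_derivative, OF assms(3)]]]
  by simp

lemma fd_minus:
  assumes "smooth_on S f" "x \<in> S"
  shows "fd (\<lambda>x. - f x) x v = - fd f x v"
  using fdI[OF has_derivative_minus[OF assms(1)[THEN smooth_on_has_derivative, OF assms(2)]]]
  by simp

lemma fd_bilinear: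
  assumes "bounded_bilinear p" "smooth_on S f" "smooth_on S g" "x \<in> S"
  shows "fd (\<lambda>x. p (f x) (g x)) x v = p (f x) (fd g x v) + p (fd f x v) (g x)"
  using fdI[OF bounded_bilinear.FDERIV[OF assms(1) assms(2,3)[THEN smooth_on_has_derivative, OF assms(4)]]]
  by simp

lemmas fd_scaleR = fd_bilinear[OF bounded_bilinear_scaleR]
lemmas fd_mult = fd_bilinear[OF bounded_bilinear_mult]

lemma fd_sum:
  assumes "\<And>i. i \<in> I \<Longrightarrow> smooth_on S (f i)" "x \<in> S"
  shows "fd (\<lambda>x. \<Sum>i\<in>I. f i x) x v = (\<Sum>i\<in>I. fd (f i) x v)"
  using fdI[OF has_derivative_sum[of I f "\<lambda>i. fd (f i) x"]]
    smooth_on_has_derivative[OF assms(1) assms(2)] by simp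

lemma fd_bounded_linear:
  assumes "bounded_linear L" "smooth_on S f" "x \<in> S"
  shows "fd (\<lambda>x. L (f x)) x v = L (fd f x v)"
  using fdI[OF bounded_linear.has_derivative[OF assms(1) smooth_on_has_derivative[OF assms(2,3)]]]
  by simp

text \<open>By the mean value theorem, used in both orders, the mixed second difference over a
  parallelogram is a value of either iterated derivative at some point of it.\<close>

lemma second_difference_mvt:
  fixes f :: "'a::real_normed_vector \<Rightarrow> real"
  assumes f: "smooth_on S f" and t: "0 < t"
    and S: "\<And>a b. 0 \<le> a \<Longrightarrow> a \<le> t \<Longrightarrow> 0 \<le> b \<Longrightarrow> b \<le> t \<Longrightarrow> x + a *\<^sub>R u + b *\<^sub>R v \<in> S"
  shows "\<exists>a b. 0 \<le> a \<and> a \<le> t \<and> 0 \<le> b \<and> b \<le> t \<and>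
    f (x + t *\<^sub>R u + t *\<^sub>R v) - f (x + t *\<^sub>R u) - f (x + t *\<^sub>R v) + f x
      = t * t * fd (\<lambda>y. fd f y u) (x + a *\<^sub>R u + b *\<^sub>R v) v"
proof -
  have d1: "((\<lambda>a. f (x + a *\<^sub>R u + b *\<^sub>R v)) has_real_derivative fd f (x + a *\<^sub>R u + b *\<^sub>R v) u) (at a)"
    if "0 \<le> a" "a \<le> t" "0 \<le> b" "b \<le> t" for a b
  proof -
    have "((\<lambda>a. x + a *\<^sub>R u + b *\<^sub>R v) has_derivative (\<lambda>r. r *\<^sub>R u)) (at a)"
      by (auto intro!: derivative_eq_intros)
    from has_derivative_compose[of _ _ a UNIV f, OF this smooth_on_has_derivative[OF f S[OF that]]]
    show ?thesis
      unfolding has_field_derivative_def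
      using linear_scale[OF smooth_on_linear_fd[OF f S[OF that]]]
      by (simp add: has_derivative_eq_rhs fun_eq_iff mult.commute)
  qed
  \<comment> \<open>The mean value theorem in direction \<open>u\<close>, applied to the difference
    of \<open>f\<close> on two opposite sides of the parallelogram. The zero multiples are kept so
    that both terms are instances of \<open>d1\<close>.\<close>
  have "\<exists>a. 0 < a \<and> a < t \<and>
    (f (x + t *\<^sub>R u + t *\<^sub>R v) - f (x + t *\<^sub>R u + 0 *\<^sub>R v)) - (f (x + 0 *\<^sub>R u + t *\<^sub>R v) - f (x + 0 *\<^sub>R u + 0 *\<^sub>R v))
      = (t - 0) * (fd f (x + a *\<^sub>R u + t *\<^sub>R v) u - fd f (x + a *\<^sub>R u + 0 *\<^sub>R v) u)"
    using t by (intro MVT2[where f="\<lambda>a. f (x + a *\<^sub>R u + t *\<^sub>R v) - f (x + a *\<^sub>R u + 0 *\<^sub>R v)"]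
        DERIV_diff d1) auto
  then obtain a where a: "0 < a" "a < t"
    and eq1: "f (x + t *\<^sub>R u + t *\<^sub>R v) - f (x + t *\<^sub>R u) - f (x + t *\<^sub>R v) + f x
      = t * (fd f (x + a *\<^sub>R u + t *\<^sub>R v) u - fd f (x + a *\<^sub>R u) u)"
    by (auto simp: algebra_simps)
  have d2: "((\<lambda>b. fd f (x + a *\<^sub>R u + b *\<^sub>R v) u) has_real_derivative
      fd (\<lambda>y. fd f y u) (x + a *\<^sub>R u + b *\<^sub>R v) v) (at b)" if "0 \<le> b" "b \<le> t" for b
  proof -
    have s: "x + a *\<^sub>R u + b *\<^sub>R v \<in> S" using S that a by simp
    have "((\<lambda>b. x + a *\<^sub>R u + b *\<^sub>R v) has_derivative (\<lambda>r. r *\<^sub>R v)) (at b)"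
      by (auto intro!: derivative_eq_intros)
    from has_derivative_compose[of _ _ b UNIV "\<lambda>y. fd f y u", OF this smooth_on_has_derivative[OF smooth_on_fd_const[OF f] s]]
    show ?thesis
      unfolding has_field_derivative_def
      using linear_scale[OF smooth_on_linear_fd[OF smooth_on_fd_const[OF f] s]]
      by (simp add: has_derivative_eq_rhs fun_eq_iff mult.commute)
  qed
  have "\<exists>b. 0 < b \<and> b < t \<and> fd f (x + a *\<^sub>R u + t *\<^sub>R v) u - fd f (x + a *\<^sub>R u + 0 *\<^sub>R v) u
      = (t - 0) * fd (\<lambda>y. fd f y u) (x + a *\<^sub>R u + b *\<^sub>R v) v"
    using t by (intro MVT2[where f="\<lambda>b. fd f (x + a *\<^sub>R u + b *\<^sub>R v) u"] d2) auto
  then obtain b where b: "0 < b" "b < t"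
    and eq2: "fd f (x + a *\<^sub>R u + t *\<^sub>R v) u - fd f (x + a *\<^sub>R u) u
      = t * fd (\<lambda>y. fd f y u) (x + a *\<^sub>R u + b *\<^sub>R v) v"
    by auto
  show ?thesis
    using a b eq1 eq2 by (intro exI[of _ a] exI[of _ b]) simp
qed

text \<open>If the two iterated derivatives differed at \<open>x\<close>, continuity would keep them
  apart on a small parallelogram; but the second difference is symmetric in \<open>u\<close> and
  \<open>v\<close>, which forces a value of one to equal a value of the other there.\<close>

lemma fd_fd_commute_real:
  fixes f :: "'a::real_normed_vector \<Rightarrow> real"
  assumes S: "open S" "x \<in> S" and f: "smooth_on S f"
  shows "fd (\<lambda>y. fd f y u) x v = fd (\<lambda>y. fd f y v) x u"
proof (rule ccontr)
  define p where "p = (\<lambda>y. fd (\<lambda>y. fd f y u) y v)"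
  define q where "q = (\<lambda>y. fd (\<lambda>y. fd f y v) y u)"
  assume "fd (\<lambda>y. fd f y u) x v \<noteq> fd (\<lambda>y. fd f y v) x u"
  then have e: "\<bar>p x - q x\<bar> / 2 > 0" (is "?e > 0")
    by (simp add: p_def q_def)
  have "continuous_on S p" "continuous_on S q"
    unfolding p_def q_def by (intro smooth_on_continuous_on smooth_on_fd_const f)+
  then have "continuous (at x) p" "continuous (at x) q"
    using S continuous_on_eq_continuous_at by blast+
  then obtain d1 d2 where d: "d1 > 0" "\<And>y. dist y x < d1 \<Longrightarrow> dist (p y) (p x) < ?e"
    "d2 > 0" "\<And>y. dist y x < d2 \<Longrightarrow> dist (q y) (q x) < ?e"
    using e unfolding continuous_at_eps_delta by metis
  obtain d3 where d3: "d3 > 0" "ball x d3 \<subseteq> S"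
    using S openE by blast
  define d where "d = min d1 (min d2 d3)"
  have d0: "d > 0" using d(1,3) d3(1) by (simp add: d_def)
  \<comment> \<open>Small enough for the whole parallelogram to stay within distance
    \<open>d\<close> of \<open>x\<close>; the summand 1 keeps the denominator positive even for
    \<open>u = v = 0\<close>.\<close>
  define t where "t = d / (2 * (norm u + norm v + 1))"
  have t0: "t > 0" using d0 by (auto simp: t_def intro!: divide_pos_pos add_nonneg_pos)
  have close: "dist (x + a *\<^sub>R u + b *\<^sub>R v) x < d" if "0 \<le> a" "a \<le> t" "0 \<le> b" "b \<le> t" for a b
  proof -
    have "dist (x + a *\<^sub>R u + b *\<^sub>R v) x = norm (a *\<^sub>R u + b *\<^sub>R v)"
      by (simp add: dist_norm add.assoc)
    also have "\<dots> \<le> a * norm u + b * norm v"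
      using norm_triangle_ineq[of "a *\<^sub>R u" "b *\<^sub>R v"] that by simp
    also have "\<dots> \<le> t * norm u + t * norm v"
      using that by (intro add_mono mult_right_mono) auto
    also have "\<dots> < t * (2 * (norm u + norm v + 1))"
      using t0 by (simp add: algebra_simps add_nonneg_pos)
    also have "\<dots> = d"
      by (simp add: t_def) (smt (verit) norm_ge_zero)
    finally show ?thesis .
  qed
  have inS: "x + a *\<^sub>R u + b *\<^sub>R v \<in> S" if "0 \<le> a" "a \<le> t" "0 \<le> b" "b \<le> t" for a b
    using close[OF that] d3(2) by (auto simp: d_def dist_commute)
  obtain a b where ab: "0 \<le> a" "a \<le> t" "0 \<le> b" "b \<le> t"
    and 1: "f (x + t *\<^sub>R u + t *\<^sub>R v) - f (x + t *\<^sub>R u) - f (x + t *\<^sub>R v) + f x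
      = t * t * p (x + a *\<^sub>R u + b *\<^sub>R v)"
    unfolding p_def using second_difference_mvt[OF f t0 inS] by blast
  have inS': "x + a *\<^sub>R v + b *\<^sub>R u \<in> S" if "0 \<le> a" "a \<le> t" "0 \<le> b" "b \<le> t" for a b
    using inS[OF that(3,4,1,2)] by (simp add: algebra_simps)
  obtain b' a' where ab': "0 \<le> a'" "a' \<le> t" "0 \<le> b'" "b' \<le> t"
    and 2: "f (x + t *\<^sub>R v + t *\<^sub>R u) - f (x + t *\<^sub>R v) - f (x + t *\<^sub>R u) + f x
      = t * t * q (x + b' *\<^sub>R v + a' *\<^sub>R u)"
    unfolding q_def using second_difference_mvt[OF f t0 inS'] by blast
  have "t * t * p (x + a *\<^sub>R u + b *\<^sub>R v) = t * t * q (x + b' *\<^sub>R v + a' *\<^sub>R u)"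
    using 1 2 by (simp add: algebra_simps)
  then have eq: "p (x + a *\<^sub>R u + b *\<^sub>R v) = q (x + a' *\<^sub>R u + b' *\<^sub>R v)"
    using t0 by (simp add: algebra_simps)
  have "dist (p (x + a *\<^sub>R u + b *\<^sub>R v)) (p x) < ?e" "dist (q (x + a' *\<^sub>R u + b' *\<^sub>R v)) (q x) < ?e"
    using close[OF ab] close[OF ab'] d by (auto simp: d_def)
  then show False
    unfolding eq dist_real_def by (smt (verit) field_sum_of_halves)
qed

text \<open>Mean values exist for real functions only, so the symmetry is transferred component by
  component.\<close>

lemma fd_fd_commute:
  fixes f :: "'a::real_normed_vector \<Rightarrow> real ^ 'i::finite"
  assumes S: "open S" "x \<in> S" and f: "smooth_on S f"
  shows "fd (\<lambda>y. fd f y u) x v = fd (\<lambda>y. fd f y v) x u"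
proof -
  have "fd (\<lambda>y. fd f y u) x v $ i = fd (\<lambda>y. fd (\<lambda>y. f y $ i) y u) x v" for i u v
  proof -
    have "fd (\<lambda>y. fd (\<lambda>y. f y $ i) y u) x = fd (\<lambda>y. fd f y u $ i) x"
      by (rule fd_cong[OF S]) (rule fd_bounded_linear[OF bounded_linear_vec_nth f])
    then show ?thesis
      by (simp add: fd_bounded_linear[OF bounded_linear_vec_nth smooth_on_fd_const[OF f] S(2)])
  qed
  then show ?thesis
    unfolding vec_eq_iff
    using fd_fd_commute_real[OF S smooth_on_vec_nth[OF S(1) f]] by metis
qed

section \<open>Families of bilinear maps\<close>

lemma linear_expand_axis:
  fixes L :: "real ^ 'i::finite \<Rightarrow> 'c::real_vector"
  assumes "linear L"
  shows "L v = (\<Sum>i\<in>UNIV. v $ i *\<^sub>R L (axis i 1))"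
proof -
  have "L v = L (\<Sum>i\<in>UNIV. v $ i *\<^sub>R axis i 1)"
    using basis_expansion[of v] by (simp add: scalar_mult_eq_scaleR)
  then show ?thesis
    by (simp add: linear_sum[OF assms] linear_scale[OF assms])
qed

lemma bilinear_expand_axis:
  fixes B :: "real ^ 'i::finite \<Rightarrow> real ^ 'j::finite \<Rightarrow> 'c::real_vector"
  assumes "bilinear B"
  shows "B u v = (\<Sum>i\<in>UNIV. \<Sum>j\<in>UNIV. (u $ i * v $ j) *\<^sub>R B (axis i 1) (axis j 1))"
proof -
  have "B u v = (\<Sum>i\<in>UNIV. u $ i *\<^sub>R B (axis i 1) v)"
    using assms unfolding bilinear_def by (intro linear_expand_axis[of "\<lambda>u. B u v"]) auto
  moreover have "B (axis i 1) v = (\<Sum>j\<in>UNIV. v $ j *\<^sub>R B (axis i 1) (axis j 1))" for i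
    using assms unfolding bilinear_def by (intro linear_expand_axis) auto
  ultimately show ?thesis
    by (simp add: scaleR_right.sum)
qed

lemma smooth_on_linear_family:
  fixes A :: "'a::real_normed_vector \<Rightarrow> real ^ 'i::finite \<Rightarrow> 'c::real_normed_vector"
  assumes S: "open S" and A: "\<And>x. x \<in> S \<Longrightarrow> linear (A x)" "\<And>u. smooth_on S (\<lambda>x. A x u)"
    and V: "smooth_on S V"
  shows "smooth_on S (\<lambda>x. A x (V x))"
proof (rule smooth_on_cong[OF S])
  show "smooth_on S (\<lambda>x. \<Sum>i\<in>UNIV. V x $ i *\<^sub>R A x (axis i 1))"
    by (intro smooth_on_sum smooth_on_scaleR smooth_on_vec_nth S A V)
qed (simp add: linear_expand_axis[OF A(1), symmetric])

text \<open>Expanding the argument in axis vectors turns evaluation into a finite sum of products.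
  The same formula for the constant field \<open>V x\<close> isolates the part in which only
  \<open>A\<close> varies.\<close>

lemma fd_linear_family:
  fixes A :: "'a::real_normed_vector \<Rightarrow> real ^ 'i::finite \<Rightarrow> 'c::real_normed_vector"
  assumes S: "open S" "x \<in> S" and A: "\<And>x. x \<in> S \<Longrightarrow> linear (A x)" "\<And>u. smooth_on S (\<lambda>x. A x u)"
    and V: "smooth_on S V"
  shows "fd (\<lambda>x. A x (V x)) x h = fd (\<lambda>y. A y (V x)) x h + A x (fd V x h)"
proof -
  have eq: "fd (\<lambda>x. A x (W x)) x = fd (\<lambda>x. \<Sum>i\<in>UNIV. W x $ i *\<^sub>R A x (axis i 1)) x" for W
    by (rule fd_cong[OF S]) (rule linear_expand_axis[OF A(1)])
  have sm: "smooth_on S (\<lambda>x. W x $ i *\<^sub>R A x (axis i 1))" if "smooth_on S W" for W i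
    by (intro smooth_on_scaleR smooth_on_vec_nth S A that)
  have der: "fd (\<lambda>x. A x (W x)) x h
    = (\<Sum>i\<in>UNIV. W x $ i *\<^sub>R fd (\<lambda>x. A x (axis i 1)) x h + fd W x h $ i *\<^sub>R A x (axis i 1))"
    if W: "smooth_on S W" for W
    by (subst eq, subst fd_sum[OF sm[OF W] S(2)])
      (simp add: fd_scaleR[OF smooth_on_vec_nth[OF S(1) W] A(2) S(2)]
        fd_bounded_linear[OF bounded_linear_vec_nth W S(2)])
  show ?thesis
    using linear_expand_axis[OF A(1)[OF S(2)], of "fd V x h"] der[OF V]
      der[OF smooth_on_const, of "V x"]
    by (simp add: sum.distrib)
qed

text \<open>A bilinear map is a linear map with values in linear maps; the two slots are treated one
  after the other.\<close>

lemma smooth_on_bilinear_family: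
  fixes B :: "'b::euclidean_space \<Rightarrow> real ^ 'i::finite \<Rightarrow> real ^ 'j::finite \<Rightarrow> 'c::real_normed_vector"
  assumes S: "open S" and B: "\<And>y. y \<in> T \<Longrightarrow> bilinear (B y)" "\<And>u v. smooth_on T (\<lambda>y. B y u v)"
    and F: "smooth_on S F" "F ` S \<subseteq> T" and V: "smooth_on S V" and W: "smooth_on S W"
  shows "smooth_on S (\<lambda>x. B (F x) (V x) (W x))"
proof (rule smooth_on_linear_family[OF S _ _ W])
  show "linear (\<lambda>w. B (F x) (V x) w)" if "x \<in> S" for x
    using B(1)[of "F x"] that F(2) unfolding bilinear_def by auto
  show "smooth_on S (\<lambda>x. B (F x) (V x) w)" for w
  proof (rule smooth_on_linear_family[OF S _ _ V])
    show "linear (\<lambda>v. B (F x) v w)" if "x \<in> S" for x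
      using B(1)[of "F x"] that F(2) unfolding bilinear_def by auto
    show "smooth_on S (\<lambda>x. B (F x) v w)" for v
      by (rule smooth_on_compose[OF S F(2) B(2) F(1)])
  qed
qed

lemma fd_bilinear_family:
  fixes B :: "'b::euclidean_space \<Rightarrow> real ^ 'i::finite \<Rightarrow> real ^ 'j::finite \<Rightarrow> 'c::real_normed_vector"
  assumes S: "open S" "x \<in> S" and B: "\<And>y. y \<in> T \<Longrightarrow> bilinear (B y)" "\<And>u v. smooth_on T (\<lambda>y. B y u v)"
    and F: "smooth_on S F" "F ` S \<subseteq> T" and V: "smooth_on S V" and W: "smooth_on S W"
  shows "fd (\<lambda>x. B (F x) (V x) (W x)) x h
    = fd (\<lambda>y. B y (V x) (W x)) (F x) (fd F x h) + B (F x) (fd V x h) (W x) + B (F x) (V x) (fd W x h)"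
proof -
  have lin: "linear (\<lambda>w. B (F x) v w)" "linear (\<lambda>v. B (F x) v w)" if "x \<in> S" for x v w
    using B(1)[of "F x"] that F(2) unfolding bilinear_def by auto
  have sm: "smooth_on S (\<lambda>x. B (F x) v w)" for v w
    by (rule smooth_on_compose[OF S(1) F(2) B(2) F(1)])
  have "fd (\<lambda>x. B (F x) (V x) (W x)) x h
      = fd (\<lambda>y. B (F y) (V y) (W x)) x h + B (F x) (V x) (fd W x h)"
    by (rule fd_linear_family[OF S lin(1) smooth_on_linear_family[OF S(1) lin(2) sm V] W])
  also have "fd (\<lambda>y. B (F y) (V y) (W x)) x h
      = fd (\<lambda>y. B (F y) (V x) (W x)) x h + B (F x) (fd V x h) (W x)"
    by (rule fd_linear_family[OF S lin(2) sm V])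
  also have "fd (\<lambda>y. B (F y) (V x) (W x)) x h = fd (\<lambda>y. B y (V x) (W x)) (F x) (fd F x h)"
    using F S by (intro fd_compose[OF B(2) F(1)]) auto
  finally show ?thesis .
qed

section \<open>Riemannian metrics on open sets\<close>

lemma bilinear_ip: "bilinear (ip A)"
  unfolding bilinear_def ip_def
  by (auto intro!: linearI simp: matrix_vector_right_distrib matrix_vector_mult_scaleR inner_add_left
      inner_add_right)

lemmas ip_simps = bilinear_ladd[OF bilinear_ip] bilinear_radd[OF bilinear_ip]
  bilinear_lsub[OF bilinear_ip] bilinear_rsub[OF bilinear_ip]
  bilinear_lneg[OF bilinear_ip] bilinear_rneg[OF bilinear_ip]
  bilinear_lmul[OF bilinear_ip] bilinear_rmul[OF bilinear_ip]
  bilinear_lzero[OF bilinear_ip] bilinear_rzero[OF bilinear_ip]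

lemma ip_axis: "ip A (axis i 1) (axis j 1) = A $ j $ i"
  by (simp add: ip_def matrix_vector_mul_component inner_axis row_def)

lemma bilinear_Gam: "bilinear (Gam G x)"
  unfolding bilinear_def Gam_def
  by (auto intro!: linearI simp: vec_eq_iff algebra_simps sum.distrib sum_distrib_left)

lemmas Gam_simps = bilinear_ladd[OF bilinear_Gam] bilinear_radd[OF bilinear_Gam]
  bilinear_lsub[OF bilinear_Gam] bilinear_rsub[OF bilinear_Gam]
  bilinear_lneg[OF bilinear_Gam] bilinear_rneg[OF bilinear_Gam]
  bilinear_lmul[OF bilinear_Gam] bilinear_rmul[OF bilinear_Gam]
  bilinear_lzero[OF bilinear_Gam] bilinear_rzero[OF bilinear_Gam]

text \<open>For constant components the bracket vanishes and the inner \<open>nabla\<close> is just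
  \<open>Gam\<close>; only the antisymmetrised derivative and square of \<open>Gam\<close>
  remain.\<close>

lemma Riem_Gam:
  "Riem G x u v w = fd (\<lambda>y. Gam G y v w) x u + Gam G x u (Gam G x v w)
     - fd (\<lambda>y. Gam G y u w) x v - Gam G x v (Gam G x u w)"
  by (simp add: Riem_def curvature_def nabla_def[abs_def] lie_bracket_def Gam_simps)

lemma gtrace_add: "gtrace A (\<lambda>u v. B u v + C u v) = gtrace A B + gtrace A C"
  by (simp add: gtrace_def scaleR_right_distrib sum.distrib)

lemma gtrace_diff: "gtrace A (\<lambda>u v. B u v - C u v) = gtrace A B - gtrace A C"
  by (simp add: gtrace_def scaleR_right_diff_distrib sum_subtractf)

lemma gtrace_linear: "linear L \<Longrightarrow> gtrace A (\<lambda>u v. L (B u v)) = L (gtrace A B)"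
  by (simp add: gtrace_def linear_sum linear_scale)

lemma gtrace_cmult: "gtrace A (\<lambda>u v. c * B u v) = c * (gtrace A B :: real)"
  by (simp add: gtrace_def sum_distrib_left mult_ac)

section \<open>Smoothness of the inverse matrix\<close>

lemma smooth_on_det:
  fixes A :: "'a::real_normed_vector \<Rightarrow> real ^ 'i::finite ^ 'i"
  assumes "open S" "\<And>i j. smooth_on S (\<lambda>x. A x $ i $ j)"
  shows "smooth_on S (\<lambda>x. det (A x))"
  unfolding det_def
  by (intro smooth_on_sum smooth_on_mult smooth_on_prod smooth_on_const assms)

lemma matrix_inv_mult:
  assumes "invertible A"
  shows "A ** matrix_inv A = mat 1" "matrix_inv A ** A = mat 1"
  using someI_ex[OF assms[unfolded invertible_def]] by (simp_all add: matrix_inv_def)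

text \<open>By Cramer's rule each entry of the inverse is a quotient of determinants, hence of
  polynomials in the entries of \<open>A x\<close>.\<close>

lemma smooth_on_matrix_inv:
  fixes A :: "'a::real_normed_vector \<Rightarrow> real ^ 'i::finite ^ 'i"
  assumes S: "open S" and A: "\<And>i j. smooth_on S (\<lambda>x. A x $ i $ j)" "\<And>x. x \<in> S \<Longrightarrow> invertible (A x)"
  shows "smooth_on S (\<lambda>x. matrix_inv (A x) $ k $ l)"
proof (rule smooth_on_cong[OF S])
  \<comment> \<open>\<open>A x\<close> with column \<open>k\<close> replaced by the
    \<open>l\<close>-th axis vector: Cramer's numerator for the system whose solution is column
    \<open>l\<close> of the inverse.\<close>
  let ?c = "\<lambda>x. \<chi> i j. if j = k then axis l 1 $ i else A x $ i $ j"
  show "smooth_on S (\<lambda>x. det (?c x) / det (A x))"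
  proof (intro smooth_on_divide smooth_on_det S A)
    show "smooth_on S (\<lambda>x. ?c x $ i $ j)" for i j
      by (cases "j = k") (simp_all add: smooth_on_const A)
    show "x \<in> S \<Longrightarrow> det (A x) \<noteq> 0" for x
      using A(2) invertible_det_nz by blast
  qed
  show "det (?c x) / det (A x) = matrix_inv (A x) $ k $ l" if "x \<in> S" for x
  proof -
    have "A x *v (matrix_inv (A x) *v axis l 1) = axis l 1"
      using A(2)[OF that] by (simp add: matrix_vector_mul_assoc matrix_inv_mult)
    then have "matrix_inv (A x) *v axis l 1 = (\<chi> k. det (\<chi> i j. if j = k then axis l 1 $ i else A x $ i $ j) / det (A x))"
      using A(2)[OF that] cramer invertible_det_nz by blast
    then have "(matrix_inv (A x) *v axis l 1) $ k = det (?c x) / det (A x)"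
      by simp
    moreover have "(matrix_inv (A x) *v axis l 1) $ k = matrix_inv (A x) $ k $ l"
      by (simp add: matrix_vector_mul_component inner_axis row_def)
    ultimately show ?thesis by simp
  qed
qed

text \<open>The geometry of a single chart. It serves for the metric of the target, for the flat
  metric conformal to it, and for the metric of the hypersurface.\<close>

locale riemannian_domain =
  fixes S :: "(real ^ 'i::finite) set" and G :: "real ^ 'i \<Rightarrow> real ^ 'i ^ 'i"
  assumes open_S: "open S" and smooth_G: "smooth_on S G"
    and sym_G: "x \<in> S \<Longrightarrow> transpose (G x) = G x"
    and pos_G: "x \<in> S \<Longrightarrow> u \<noteq> 0 \<Longrightarrow> ip (G x) u u > 0"
begin

lemma ip_commute: "x \<in> S \<Longrightarrow> ip (G x) u v = ip (G x) v u"
  using sym_G[of x] by (metis ip_def dot_lmul_matrix inner_commute transpose_matrix_vector)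

lemma ip_eqI:
  assumes "x \<in> S" "\<And>w. ip (G x) u w = ip (G x) v w"
  shows "u = v"
proof -
  have "ip (G x) (u - v) (u - v) = 0"
    using assms(2)[of "u - v"] by (simp add: ip_simps)
  then show ?thesis
    using pos_G[OF assms(1), of "u - v"] by fastforce
qed

lemma invertible_G: "x \<in> S \<Longrightarrow> invertible (G x)"
  unfolding invertible_left_inverse matrix_left_invertible_ker
  by (metis inner_zero_left ip_def less_irrefl pos_G)

lemma G_inv: "x \<in> S \<Longrightarrow> G x *v (matrix_inv (G x) *v a) = a"
  using invertible_G by (simp add: matrix_vector_mul_assoc matrix_inv_mult)

lemma inv_G: "x \<in> S \<Longrightarrow> matrix_inv (G x) *v (G x *v a) = a"
  using invertible_G by (simp add: matrix_vector_mul_assoc matrix_inv_mult)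

lemma ip_inv: "x \<in> S \<Longrightarrow> ip (G x) (matrix_inv (G x) *v a) v = a \<bullet> v"
  by (simp add: ip_def G_inv)

lemma smooth_entries: "smooth_on S (\<lambda>x. G x $ i $ j)"
  by (rule smooth_on_vec_nth[OF open_S smooth_on_vec_nth[OF open_S smooth_G]])

lemma smooth_inv: "smooth_on S (\<lambda>x. matrix_inv (G x) $ i $ j)"
  by (rule smooth_on_matrix_inv[OF open_S smooth_entries invertible_G])

lemma smooth_ip_const: "smooth_on S (\<lambda>x. ip (G x) u v)"
proof -
  have "(\<lambda>x. ip (G x) u v) = (\<lambda>x. \<Sum>i\<in>UNIV. \<Sum>j\<in>UNIV. (u $ i * v $ j) *\<^sub>R (G x $ j $ i))"
    by (subst bilinear_expand_axis[OF bilinear_ip]) (simp add: ip_axis)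
  then show ?thesis
    by (simp only:) (intro smooth_on_sum smooth_on_scaleR smooth_on_const smooth_entries open_S)
qed

lemma fd_ip_const:
  assumes "x \<in> S"
  shows "fd (\<lambda>y. ip (G y) v w) x u
    = (\<Sum>i\<in>UNIV. \<Sum>j\<in>UNIV. \<Sum>l\<in>UNIV. pd i (\<lambda>y. G y $ j $ l) x * u $ i * v $ j * w $ l)"
proof -
  \<comment> \<open>\<open>ip_axis\<close> delivers the transposed entry; symmetry of
    \<open>G y\<close> restores the index order used in \<open>christoffel\<close>.\<close>
  have e: "ip (G y) v w = (\<Sum>j\<in>UNIV. \<Sum>l\<in>UNIV. (v $ j * w $ l) *\<^sub>R (G y $ j $ l))" if "y \<in> S" for y
    using sym_G[OF that]
    by (subst bilinear_expand_axis[OF bilinear_ip]) (simp add: ip_axis transpose_def vec_eq_iff)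
  have "fd (\<lambda>y. ip (G y) v w) x = fd (\<lambda>y. \<Sum>j\<in>UNIV. \<Sum>l\<in>UNIV. (v $ j * w $ l) *\<^sub>R (G y $ j $ l)) x"
    by (rule fd_cong[OF open_S assms e])
  then have "fd (\<lambda>y. ip (G y) v w) x k
      = (\<Sum>j\<in>UNIV. \<Sum>l\<in>UNIV. v $ j * w $ l * fd (\<lambda>y. G y $ j $ l) x k)" for k
    by (simp add: fd_sum[of _ S] fd_mult[of S] smooth_on_sum smooth_on_mult smooth_on_const
        smooth_entries open_S assms)
  then have "fd (\<lambda>y. ip (G y) v w) x u
      = (\<Sum>i\<in>UNIV. u $ i *\<^sub>R (\<Sum>j\<in>UNIV. \<Sum>l\<in>UNIV. v $ j * w $ l * pd i (\<lambda>y. G y $ j $ l) x))"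
    using linear_expand_axis[OF smooth_on_linear_fd[OF smooth_ip_const assms], of v w u] by simp
  then show ?thesis
    by (simp add: sum_distrib_left mult_ac)
qed

text \<open>Koszul's formula for fields with constant components, whose brackets vanish. It is the
  only place where the sums defining the Christoffel symbols are rearranged.\<close>

lemma ip_Gam:
  assumes "x \<in> S"
  shows "ip (G x) (Gam G x u v) w = (1/2) * (fd (\<lambda>y. ip (G y) v w) x u
    + fd (\<lambda>y. ip (G y) u w) x v - fd (\<lambda>y. ip (G y) u v) x w)"
proof -
  define c where "c l i j = pd i (\<lambda>y. G y $ j $ l) x + pd j (\<lambda>y. G y $ i $ l) x
    - pd l (\<lambda>y. G y $ i $ j) x" for l i j
  \<comment> \<open>The Christoffel symbols of the first kind, contracted with \<open>u\<close> and
    \<open>v\<close>; raising the index gives \<open>Gam\<close>.\<close>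
  define C where "C = (\<chi> l. (1/2) * (\<Sum>i\<in>UNIV. \<Sum>j\<in>UNIV. c l i j * u $ i * v $ j))"
  have "Gam G x u v $ k = (matrix_inv (G x) *v C) $ k" for k
  proof -
    have "Gam G x u v $ k = (\<Sum>i\<in>UNIV. \<Sum>j\<in>UNIV. \<Sum>l\<in>UNIV.
        matrix_inv (G x) $ k $ l * ((1/2) * (c l i j * u $ i * v $ j)))"
      by (simp add: Gam_def christoffel_def c_def[symmetric] sum_distrib_left sum_distrib_right mult_ac)
    also have "\<dots> = (\<Sum>i\<in>UNIV. \<Sum>l\<in>UNIV. \<Sum>j\<in>UNIV.
        matrix_inv (G x) $ k $ l * ((1/2) * (c l i j * u $ i * v $ j)))"
      by (intro sum.cong refl sum.swap)
    also have "\<dots> = (\<Sum>l\<in>UNIV. \<Sum>i\<in>UNIV. \<Sum>j\<in>UNIV.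
        matrix_inv (G x) $ k $ l * ((1/2) * (c l i j * u $ i * v $ j)))"
      by (rule sum.swap)
    also have "\<dots> = (matrix_inv (G x) *v C) $ k"
      by (simp add: matrix_vector_mult_def C_def sum_distrib_left)
    finally show ?thesis .
  qed
  then have "Gam G x u v = matrix_inv (G x) *v C"
    by (simp add: vec_eq_iff)
  then have "ip (G x) (Gam G x u v) w = C \<bullet> w"
    by (simp add: ip_inv[OF assms])
  also have "\<dots> = (1/2) * (\<Sum>l\<in>UNIV. \<Sum>i\<in>UNIV. \<Sum>j\<in>UNIV. c l i j * u $ i * v $ j * w $ l)"
    by (simp add: C_def inner_vec_def sum_distrib_left sum_distrib_right mult_ac)
  also have "(\<Sum>l\<in>UNIV. \<Sum>i\<in>UNIV. \<Sum>j\<in>UNIV. c l i j * u $ i * v $ j * w $ l)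
    = (\<Sum>l\<in>UNIV. \<Sum>i\<in>UNIV. \<Sum>j\<in>UNIV. pd i (\<lambda>y. G y $ j $ l) x * u $ i * v $ j * w $ l)
      + (\<Sum>l\<in>UNIV. \<Sum>i\<in>UNIV. \<Sum>j\<in>UNIV. pd j (\<lambda>y. G y $ i $ l) x * u $ i * v $ j * w $ l)
      - (\<Sum>l\<in>UNIV. \<Sum>i\<in>UNIV. \<Sum>j\<in>UNIV. pd l (\<lambda>y. G y $ i $ j) x * u $ i * v $ j * w $ l)"
    by (simp add: c_def algebra_simps sum.distrib sum_subtractf)
  also have "(\<Sum>l\<in>UNIV. \<Sum>i\<in>UNIV. \<Sum>j\<in>UNIV. pd i (\<lambda>y. G y $ j $ l) x * u $ i * v $ j * w $ l)
    = fd (\<lambda>y. ip (G y) v w) x u"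
    unfolding fd_ip_const[OF assms]
    by (subst sum.swap) (intro sum.cong refl sum.swap)
  also have "(\<Sum>l\<in>UNIV. \<Sum>i\<in>UNIV. \<Sum>j\<in>UNIV. pd j (\<lambda>y. G y $ i $ l) x * u $ i * v $ j * w $ l)
    = (\<Sum>l\<in>UNIV. \<Sum>j\<in>UNIV. \<Sum>i\<in>UNIV. pd j (\<lambda>y. G y $ i $ l) x * v $ j * u $ i * w $ l)"
    by (subst sum.swap[of _ UNIV UNIV]) (simp add: mult_ac)
  also have "\<dots> = fd (\<lambda>y. ip (G y) u w) x v"
    unfolding fd_ip_const[OF assms]
    by (subst sum.swap) (intro sum.cong refl sum.swap)
  also have "(\<Sum>l\<in>UNIV. \<Sum>i\<in>UNIV. \<Sum>j\<in>UNIV. pd l (\<lambda>y. G y $ i $ j) x * u $ i * v $ j * w $ l)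
    = fd (\<lambda>y. ip (G y) u v) x w"
    unfolding fd_ip_const[OF assms] by (simp add: mult_ac)
  finally show ?thesis .
qed

lemma fd_ip_commute: "x \<in> S \<Longrightarrow> fd (\<lambda>y. ip (G y) u v) x = fd (\<lambda>y. ip (G y) v u) x"
  by (rule fd_cong[OF open_S]) (auto intro: ip_commute)

lemma Gam_commute: "x \<in> S \<Longrightarrow> Gam G x u v = Gam G x v u"
  by (rule ip_eqI, assumption) (simp add: ip_Gam fd_ip_commute[of x u v])

lemma metric_compatible:
  assumes "x \<in> S"
  shows "fd (\<lambda>y. ip (G y) u v) x w = ip (G x) (Gam G x w u) v + ip (G x) u (Gam G x w v)"
  unfolding ip_commute[OF assms, of u "Gam G x w v"] ip_Gam[OF assms]
  using fd_ip_commute[OF assms, of v u] fd_ip_commute[OF assms, of w v] fd_ip_commute[OF assms, of w u]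
  by (simp add: field_simps)

text \<open>The uniqueness half of the fundamental theorem, at one point: the two conditions put
  \<open>C\<close> into Koszul's formula. It identifies the connection both after a conformal change
  and on the hypersurface.\<close>

lemma Gam_unique:
  assumes x: "x \<in> S" and sym: "\<And>u v. C u v = C v u"
    and comp: "\<And>u v w. fd (\<lambda>y. ip (G y) u v) x w = ip (G x) (C w u) v + ip (G x) u (C w v)"
  shows "C u v = Gam G x u v"
proof (rule ip_eqI[OF x])
  fix w
  show "ip (G x) (C u v) w = ip (G x) (Gam G x u v) w"
    unfolding ip_Gam[OF x] comp
    using sym[of v u] sym[of w u] sym[of w v] ip_commute[OF x, of u "C v w"]
      ip_commute[OF x, of v "C u w"]  ip_commute[OF x, of w "C u v"]
      ip_commute[OF x, of u "C w v"] ip_commute[OF x, of v "C w u"]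
    by simp
qed

lemma smooth_Gam_const: "smooth_on S (\<lambda>x. Gam G x u v)"
proof (rule smooth_on_componentwise[OF open_S])
  show "smooth_on S (\<lambda>x. Gam G x u v $ k)" for k
    unfolding Gam_def christoffel_def vec_lambda_beta
    by (intro smooth_on_sum smooth_on_mult smooth_on_const smooth_inv
        smooth_on_diff smooth_on_add smooth_on_fd_const smooth_entries open_S)
qed

text \<open>The basis dual to the axis vectors with respect to the metric. Pairing axis vectors with
  it replaces an orthonormal frame in every trace.\<close>

definition cobasis :: "real ^ 'i \<Rightarrow> 'i \<Rightarrow> real ^ 'i" where
  "cobasis x i = matrix_inv (G x) *v axis i 1"

lemma ip_cobasis: "x \<in> S \<Longrightarrow> ip (G x) v (cobasis x i) = v $ i"
  by (simp add: ip_commute[of x v] cobasis_def ip_inv inner_commute[of "axis i 1"] inner_axis)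

lemma cobasis_expand:
  assumes "x \<in> S"
  shows "(\<Sum>i\<in>UNIV. ip (G x) v (axis i 1) *\<^sub>R cobasis x i) = v"
proof -
  have "(\<Sum>i\<in>UNIV. ip (G x) v (axis i 1) *\<^sub>R cobasis x i)
      = matrix_inv (G x) *v (\<Sum>i\<in>UNIV. (G x *v v) $ i *\<^sub>R axis i 1)"
    by (simp add: cobasis_def ip_def inner_axis matrix_vector_mult_scaleR
        linear_sum[OF matrix_vector_mul_linear])
  also have "(\<Sum>i\<in>UNIV. (G x *v v) $ i *\<^sub>R axis i 1) = G x *v v"
    using basis_expansion[of "G x *v v"] by (simp add: scalar_mult_eq_scaleR)
  finally show ?thesis
    by (simp add: inv_G[OF assms])
qed

lemma inv_commute:
  assumes "x \<in> S"
  shows "matrix_inv (G x) $ i $ j = matrix_inv (G x) $ j $ i"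
proof -
  have "matrix_inv (G x) $ i $ j = ip (G x) (cobasis x j) (cobasis x i)" for i j
    by (simp add: ip_cobasis[OF assms]) (simp add: cobasis_def matrix_vector_mul_component inner_axis row_def)
  then show ?thesis
    using ip_commute[OF assms] by metis
qed

lemma gtrace_cobasis:
  assumes "x \<in> S" "\<And>u. linear (B u)"
  shows "gtrace (G x) B = (\<Sum>i\<in>UNIV. B (axis i 1) (cobasis x i))"
proof -
  have "B (axis i 1) (cobasis x i) = (\<Sum>j\<in>UNIV. matrix_inv (G x) $ i $ j *\<^sub>R B (axis i 1) (axis j 1))"
    for i
  proof -
    have "cobasis x i $ j = matrix_inv (G x) $ i $ j" for j
      using inv_commute[OF assms(1), of i j]
      by (simp add: cobasis_def matrix_vector_mul_component inner_axis row_def)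
    then show ?thesis
      using linear_expand_axis[OF assms(2), of "axis i 1" "cobasis x i"] by simp
  qed
  then show ?thesis
    by (simp add: gtrace_def)
qed

text \<open>Pairing with the \<open>i\<close>-th dual vector reads off the \<open>i\<close>-th
  component, so the metric trace sums the diagonal of the matrix of \<open>L\<close>.\<close>

lemma gtrace_endo: "x \<in> S \<Longrightarrow> gtrace (G x) (\<lambda>u v. ip (G x) (L u) v) = trace (matrix L)"
  using bilinear_ip[of "G x"]
  by (subst gtrace_cobasis) (auto simp: bilinear_def ip_cobasis trace_def matrix_def)

lemma ip_grad:
  assumes "x \<in> S" "smooth_on S f"
  shows "ip (G x) (grad G f x) v = fd f x v"
  using linear_expand_axis[OF smooth_on_linear_fd[OF assms(2,1)], of v]
  by (simp add: grad_def ip_inv[OF assms(1)] inner_vec_def mult.commute)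

text \<open>Contracting with a differential means inserting its gradient. Here the differential
  occupies the first slot, and the gradient is assembled from the dual vectors; in the second slot
  it is assembled from its components.\<close>

lemma gtrace_grad1:
  assumes "x \<in> S" "smooth_on S f" "linear L"
  shows "gtrace (G x) (\<lambda>u v. fd f x u *\<^sub>R L v) = L (grad G f x)"
proof -
  have "gtrace (G x) (\<lambda>u v. fd f x u *\<^sub>R L v) = (\<Sum>i\<in>UNIV. fd f x (axis i 1) *\<^sub>R L (cobasis x i))"
    by (rule gtrace_cobasis[OF assms(1)]) (rule linear_compose_scale_right[OF assms(3)])
  also have "\<dots> = L (\<Sum>i\<in>UNIV. ip (G x) (grad G f x) (axis i 1) *\<^sub>R cobasis x i)"
    by (simp add: linear_sum[OF assms(3)] linear_scale[OF assms(3)] ip_grad[OF assms(1,2)])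
  finally show ?thesis
    by (simp add: cobasis_expand[OF assms(1)])
qed

lemma gtrace_grad2:
  assumes "x \<in> S" "smooth_on S f" "linear L"
  shows "gtrace (G x) (\<lambda>u v. fd f x v *\<^sub>R L u) = L (grad G f x)"
proof -
  have "gtrace (G x) (\<lambda>u v. fd f x v *\<^sub>R L u) = (\<Sum>i\<in>UNIV. fd f x (cobasis x i) *\<^sub>R L (axis i 1))"
    using smooth_on_linear_fd[OF assms(2,1)]
    by (intro gtrace_cobasis[OF assms(1)] linearI)
      (simp_all add: linear_add[of "fd f x"] linear_scale[of "fd f x"] scaleR_left_distrib)
  also have "\<dots> = (\<Sum>i\<in>UNIV. grad G f x $ i *\<^sub>R L (axis i 1))"
    by (simp add: ip_grad[OF assms(1,2), symmetric] ip_cobasis[OF assms(1)])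
  finally show ?thesis
    by (simp only: linear_expand_axis[OF assms(3), of "grad G f x"])
qed

lemma smooth_grad:
  assumes "smooth_on S f"
  shows "smooth_on S (grad G f)"
proof (rule smooth_on_componentwise[OF open_S])
  show "smooth_on S (\<lambda>x. grad G f x $ k)" for k
    unfolding grad_def matrix_vector_mult_def vec_lambda_beta
    by (intro smooth_on_sum smooth_on_mult smooth_inv smooth_on_fd_const assms open_S)
qed

lemma Hess_commute:
  assumes "smooth_on S f" "x \<in> S"
  shows "Hess G f x u v = Hess G f x v u"
  unfolding Hess_def
  using fd_fd_commute_real[OF open_S assms(2,1)] Gam_commute[OF assms(2)] by metis

lemma bilinear_Hess:
  assumes "smooth_on S f" "x \<in> S"
  shows "bilinear (Hess G f x)"
proof -
  have l: "linear (\<lambda>u. Hess G f x u v)" for v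
    unfolding Hess_def
    using smooth_on_linear_fd[OF smooth_on_fd_const[OF assms(1)] assms(2), of v]
      smooth_on_linear_fd[OF assms] bilinear_Gam[of G x]
    by (intro linear_compose_sub linear_compose[unfolded o_def, of "\<lambda>u. Gam G x u v" "fd f x"])
      (auto simp: bilinear_def)
  \<comment> \<open>In the second slot the argument sits inside a differentiated function; symmetry
    of the Hessian moves it to the first slot.\<close>
  moreover have "linear (Hess G f x u)" for u
  proof (rule ssubst[of _ _ linear])
    show "Hess G f x u = (\<lambda>v. Hess G f x v u)"
      by (rule ext) (rule Hess_commute[OF assms])
  qed (rule l)
  ultimately show ?thesis
    unfolding bilinear_def by blast
qed

lemma gtrace_eval1:
  assumes "x \<in> S" "linear L"
  shows "gtrace (G x) (\<lambda>u v. ip (G x) w v *\<^sub>R L u) = L w"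
proof -
  have "gtrace (G x) (\<lambda>u v. ip (G x) w v *\<^sub>R L u) = (\<Sum>i\<in>UNIV. ip (G x) w (cobasis x i) *\<^sub>R L (axis i 1))"
    by (intro gtrace_cobasis[OF assms(1)] linearI) (simp_all add: ip_simps scaleR_left_distrib)
  then show ?thesis
    by (simp only: ip_cobasis[OF assms(1)] linear_expand_axis[OF assms(2), of w])
qed

lemma gtrace_eval2:
  assumes "x \<in> S" "linear L"
  shows "gtrace (G x) (\<lambda>u v. ip (G x) u w *\<^sub>R L v) = L w"
proof -
  have "gtrace (G x) (\<lambda>u v. ip (G x) u w *\<^sub>R L v) = (\<Sum>i\<in>UNIV. ip (G x) (axis i 1) w *\<^sub>R L (cobasis x i))"
    by (rule gtrace_cobasis[OF assms(1)]) (rule linear_compose_scale_right[OF assms(2)])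
  also have "\<dots> = L (\<Sum>i\<in>UNIV. ip (G x) w (axis i 1) *\<^sub>R cobasis x i)"
    by (simp add: linear_sum[OF assms(2)] linear_scale[OF assms(2)] ip_commute[OF assms(1), of w])
  finally show ?thesis
    by (simp add: cobasis_expand[OF assms(1)])
qed

lemma gtrace_metric: "x \<in> S \<Longrightarrow> gtrace (G x) (ip (G x)) = real CARD('i)"
  using gtrace_endo[of x "\<lambda>u. u"] matrix_id_mat_1 trace_I by (metis eq_id_iff)

lemma grad_cmult:
  assumes "smooth_on S f" "x \<in> S"
  shows "grad G (\<lambda>y. c * f y) x = c *\<^sub>R grad G f x"
  using smooth_on_mult[OF open_S smooth_on_const assms(1)] fd_mult[OF smooth_on_const assms]
  by (intro ip_eqI[OF assms(2)]) (simp add: ip_simps ip_grad assms)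

lemma grad_power2:
  assumes "smooth_on S f" "x \<in> S"
  shows "grad G (\<lambda>y. (f y)\<^sup>2) x = (2 * f x) *\<^sub>R grad G f x"
  using smooth_on_mult[OF open_S assms(1,1)] fd_mult[OF assms(1,1,2)]
  by (intro ip_eqI[OF assms(2)]) (simp add: ip_simps ip_grad assms power2_eq_square)

lemma Laplace_cmult:
  assumes "smooth_on S f" "x \<in> S"
  shows "Laplace G (\<lambda>y. c * f y) x = c * Laplace G f x"
proof -
  have 1: "fd (\<lambda>y. c * f y) y v = c * fd f y v" if "y \<in> S" for y v
    using fd_mult[OF smooth_on_const assms(1) that] by simp
  have "fd (\<lambda>y. fd (\<lambda>y. c * f y) y v) x = fd (\<lambda>y. c * fd f y v) x" for v
    by (rule fd_cong[OF open_S assms(2) 1])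
  then have "Hess G (\<lambda>y. c * f y) x = (\<lambda>u v. c * Hess G f x u v)"
    using fd_mult[OF smooth_on_const smooth_on_fd_const[OF assms(1)] assms(2)]
    by (auto simp: Hess_def 1[OF assms(2)] fun_eq_iff algebra_simps)
  then show ?thesis
    by (simp add: Laplace_def gtrace_cmult)
qed

end

section \<open>Vector fields along maps\<close>

lemma nabla_along_cong:
  assumes "open U" "x \<in> U" "\<And>y. y \<in> U \<Longrightarrow> V y = W y"
  shows "nabla_along K F u V x = nabla_along K F u W x"
  using fd_cong[OF assms] assms(2,3) by (simp add: nabla_along_def)

text \<open>Stated for arbitrary maps, so that the identity is an instance as well; for it
  \<open>nabla_along\<close> is the Levi-Civita derivative of ordinary vector fields.\<close>

locale map_into_riemannian_domain = riemannian_domain T K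
  for T :: "(real ^ 'n::finite) set" and K +
  fixes U :: "(real ^ 'm::finite) set" and F :: "real ^ 'm \<Rightarrow> real ^ 'n"
  assumes open_U: "open U" and smooth_F: "smooth_on U F" and F_image: "F ` U \<subseteq> T"
begin

abbreviation D :: "real ^ 'm \<Rightarrow> (real ^ 'm \<Rightarrow> real ^ 'n) \<Rightarrow> real ^ 'm \<Rightarrow> real ^ 'n" where
  "D \<equiv> nabla_along K F"

lemma F_in: "x \<in> U \<Longrightarrow> F x \<in> T"
  using F_image by auto

lemma smooth_dF: "smooth_on U V \<Longrightarrow> smooth_on U (\<lambda>x. fd F x (V x))"
  by (rule smooth_on_fd[of U "\<lambda>x. x"]) (auto simp: open_U smooth_F smooth_on_id)

lemma linear_dF: "x \<in> U \<Longrightarrow> linear (fd F x)"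
  by (rule smooth_on_linear_fd[OF smooth_F])

lemma smooth_ip:
  "smooth_on U V \<Longrightarrow> smooth_on U W \<Longrightarrow> smooth_on U (\<lambda>x. ip (K (F x)) (V x) (W x))"
  by (rule smooth_on_bilinear_family[OF open_U bilinear_ip smooth_ip_const smooth_F F_image])

lemma smooth_Gam_along:
  "smooth_on U V \<Longrightarrow> smooth_on U W \<Longrightarrow> smooth_on U (\<lambda>x. Gam K (F x) (V x) (W x))"
  by (rule smooth_on_bilinear_family[OF open_U bilinear_Gam smooth_Gam_const smooth_F F_image])

lemma smooth_D:
  assumes "smooth_on U V" "smooth_on U W"
  shows "smooth_on U (\<lambda>x. D (W x) V x)"
  unfolding nabla_along_def
  by (intro smooth_on_add smooth_Gam_along smooth_dF smooth_on_fd[of U "\<lambda>x. x" U] smooth_on_id open_U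
      assms) auto

lemma linear_D: "smooth_on U V \<Longrightarrow> x \<in> U \<Longrightarrow> linear (\<lambda>u. D u V x)"
  unfolding nabla_along_def
  using linear_dF[of x] smooth_on_linear_fd[of U V x] bilinear_Gam[of K "F x"]
  by (intro linear_compose_add linear_compose[unfolded o_def, of "fd F x" "\<lambda>u. Gam K (F x) u (V x)"])
    (auto simp: bilinear_def)

lemma D_diff:
  "smooth_on U V \<Longrightarrow> smooth_on U W \<Longrightarrow> x \<in> U \<Longrightarrow> D u (\<lambda>x. V x - W x) x = D u V x - D u W x"
  by (simp add: nabla_along_def fd_diff[of U] Gam_simps)

lemma D_scaleR:
  "smooth_on U f \<Longrightarrow> smooth_on U V \<Longrightarrow> x \<in> U \<Longrightarrow>
    D u (\<lambda>x. f x *\<^sub>R V x) x = fd f x u *\<^sub>R V x + f x *\<^sub>R D u V x"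
  by (simp add: nabla_along_def fd_scaleR[of U] Gam_simps algebra_simps)

text \<open>The product rule leaves a derivative of the metric in direction \<open>fd F x u\<close>;
  \<open>metric_compatible\<close> splits it into the \<open>Gam\<close> terms of the two covariant
  derivatives.\<close>

lemma fd_ip:
  assumes "smooth_on U V" "smooth_on U W" "x \<in> U"
  shows "fd (\<lambda>x. ip (K (F x)) (V x) (W x)) x u = ip (K (F x)) (D u V x) (W x) + ip (K (F x)) (V x) (D u W x)"
  by (subst fd_bilinear_family[OF open_U assms(3) bilinear_ip smooth_ip_const smooth_F F_image assms(1,2)])
    (simp add: metric_compatible[OF F_in[OF assms(3)]] nabla_along_def ip_simps)

text \<open>Freedom from torsion, pulled back: second derivatives of \<open>F\<close> and
  \<open>Gam\<close> are both symmetric.\<close>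

lemma D_dF_commute:
  assumes "x \<in> U"
  shows "D u (\<lambda>y. fd F y v) x = D v (\<lambda>y. fd F y u) x"
  using fd_fd_commute[OF open_U assms smooth_F, of v u] Gam_commute[OF F_in[OF assms]]
  by (simp add: nabla_along_def)

text \<open>The curvature of the induced connection is the pulled-back curvature. Constant
  \<open>u\<close> and \<open>v\<close> commute, so there is no bracket term, and everything
  symmetric in them cancels.\<close>

lemma D_D_commute:
  assumes V: "smooth_on U V" and x: "x \<in> U"
  shows "D u (D v V) x - D v (D u V) x = Riem K (F x) (fd F x u) (fd F x v) (V x)"
proof -
  have *: "D u (D v V) x = fd (\<lambda>y. fd V y v) x u
      + fd (\<lambda>y. Gam K y (fd F x v) (V x)) (F x) (fd F x u)
      + Gam K (F x) (fd (\<lambda>y. fd F y v) x u) (V x) + Gam K (F x) (fd F x v) (fd V x u)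
      + Gam K (F x) (fd F x u) (fd V x v) + Gam K (F x) (fd F x u) (Gam K (F x) (fd F x v) (V x))" for u v
    unfolding nabla_along_def
    by (subst fd_add[OF smooth_on_fd_const[OF V] smooth_Gam_along[OF smooth_on_fd_const[OF smooth_F] V] x],
        subst fd_bilinear_family[OF open_U x bilinear_Gam smooth_Gam_const smooth_F F_image
          smooth_on_fd_const[OF smooth_F] V]) (simp add: Gam_simps)
  show ?thesis
    unfolding * Riem_Gam
    using fd_fd_commute[OF open_U x V, of u v] fd_fd_commute[OF open_U x smooth_F, of u v]
    by simp
qed

end

section \<open>Conformally flat metrics\<close>

locale conformal_metrics = riemannian_domain T K + bar: riemannian_domain T Kb
  for T :: "(real ^ 'n::finite) set" and K Kb +
  fixes s :: "real ^ 'n \<Rightarrow> real"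
  assumes smooth_s: "smooth_on T s"
    and conformal: "y \<in> T \<Longrightarrow> K y = exp (- 2 * s y) *\<^sub>R Kb y"
begin

sublocale ident: map_into_riemannian_domain T K T "\<lambda>y. y"
  by unfold_locales (auto simp: open_S smooth_on_id)

lemma smooth_ds: "smooth_on T (\<lambda>y. fd s y v)"
  by (rule smooth_on_fd_const[OF smooth_s])

lemma linear_ds: "y \<in> T \<Longrightarrow> linear (fd s y)"
  by (rule smooth_on_linear_fd[OF smooth_s])

text \<open>The right-hand side is symmetric and compatible with \<open>Kb\<close>, so uniqueness
  identifies it with the connection of \<open>Kb\<close>.\<close>

lemma Gam_conformal:
  assumes y: "y \<in> T"
  shows "Gam Kb y u v = Gam K y u v + fd s y u *\<^sub>R v + fd s y v *\<^sub>R u - ip (K y) u v *\<^sub>R grad K s y"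
    (is "_ = ?C u v")
proof (rule bar.Gam_unique[OF y, symmetric])
  show "?C u v = ?C v u" for u v
    by (simp add: Gam_commute[OF y, of u] ip_commute[OF y, of u])
  fix u v w
  have e: "ip (Kb y) a b = exp (2 * s y) * ip (K y) a b" if "y \<in> T" for y a b
    using conformal[OF that]
    by (simp add: ip_def scaleR_matrix_vector_assoc[symmetric] flip: exp_add)
  \<comment> \<open>Differentiating the conformal factor contributes \<open>2 * fd s y w\<close>.
    The three correction terms of \<open>?C\<close> yield exactly this multiple of the inner product
    of \<open>u\<close> and \<open>v\<close>, the rest cancelling in pairs.\<close>
  have "((\<lambda>y. exp (2 * s y)) has_derivative (\<lambda>k. exp (2 * s y) * (2 * fd s y k))) (at y)"
    using smooth_on_has_derivative[OF smooth_s y] by (auto intro!: derivative_eq_intros)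
  from has_derivative_mult[OF this smooth_on_has_derivative[OF smooth_ip_const y]]
  have "fd (\<lambda>y. exp (2 * s y) * ip (K y) u v) y w
      = exp (2 * s y) * fd (\<lambda>y. ip (K y) u v) y w + exp (2 * s y) * (2 * fd s y w) * ip (K y) u v"
    by (subst fdI) auto
  moreover have "fd (\<lambda>y. ip (Kb y) u v) y = fd (\<lambda>y. exp (2 * s y) * ip (K y) u v) y"
    by (rule fd_cong[OF open_S y e])
  ultimately show "fd (\<lambda>y. ip (Kb y) u v) y w = ip (Kb y) (?C w u) v + ip (Kb y) u (?C w v)"
    using ip_grad[OF y smooth_s] ip_commute[OF y, of u "grad K s y"] ip_commute[OF y, of u w]
    by (simp add: e[OF y] metric_compatible[OF y] ip_simps algebra_simps)
qed

text \<open>Differentiate the identity between \<open>fd s y v\<close> and the inner product of the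
  gradient with a constant \<open>v\<close>; the term with \<open>Gam K y u v\<close> is the
  correction in \<open>Hess\<close>.\<close>

lemma Hess_grad:
  assumes y: "y \<in> T"
  shows "ip (K y) (fd (grad K s) y u + Gam K y u (grad K s y)) v = Hess K s y u v"
proof -
  have "fd (\<lambda>y. fd s y v) y = fd (\<lambda>y. ip (K y) (grad K s y) v) y"
    by (rule fd_cong[OF open_S y]) (simp add: ip_grad smooth_s)
  then show ?thesis
    using ident.fd_ip[OF smooth_grad[OF smooth_s] smooth_on_const[of T v] y, of u]
      ip_grad[OF y smooth_s]
    by (simp add: Hess_def nabla_along_def ip_simps)
qed

text \<open>For flat \<open>Kb\<close>, the conformal change formula makes this the Schouten tensor of \<open>K\<close>.\<close>

definition schouten :: "real ^ 'n \<Rightarrow> real ^ 'n \<Rightarrow> real ^ 'n \<Rightarrow> real" where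
  "schouten y u v = Hess K s y u v - fd s y u * fd s y v
     + (1/2) * ip (K y) (grad K s y) (grad K s y) * ip (K y) u v"

text \<open>Ordinary second derivatives of \<open>s\<close> are traded for \<open>Hess\<close>, and
  those of the gradient for its covariant derivative \<open>N\<close>. Once all terms are paired
  with \<open>z\<close>, antisymmetry removes the leftover \<open>Gam\<close> terms, and a
  polynomial identity in finitely many scalars remains.\<close>

lemma Riem_conformal:
  assumes y: "y \<in> T"
  shows "ip (K y) (Riem Kb y u v w) z = ip (K y) (Riem K y u v w) z
    - schouten y v w * ip (K y) u z + schouten y u w * ip (K y) v z
    - ip (K y) v w * schouten y u z + ip (K y) u w * schouten y v z"
proof -
  define n where "n = grad K s y"
  define N where "N u = fd (grad K s) y u + Gam K y u n" for u
  have dn: "fd (grad K s) y u = N u - Gam K y u n" for u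
    by (simp add: N_def)
  have dds: "fd (\<lambda>y. fd s y v) y u = Hess K s y u v + fd s y (Gam K y u v)" for u v
    by (simp add: Hess_def)
  have ipn: "ip (K y) n u = fd s y u" "ip (K y) u n = fd s y u" for u
    using ip_grad[OF y smooth_s] ip_commute[OF y] by (simp_all add: n_def)
  have ipN: "ip (K y) (N u) v = Hess K s y u v" for u v
    using Hess_grad[OF y] by (simp add: N_def n_def)
  have dG: "fd (\<lambda>y. Gam Kb y v w) y u = fd (\<lambda>y. Gam K y v w) y u
      + (Hess K s y u v + fd s y (Gam K y u v)) *\<^sub>R w + (Hess K s y u w + fd s y (Gam K y u w)) *\<^sub>R v
      - (ip (K y) (Gam K y u v) w + ip (K y) v (Gam K y u w)) *\<^sub>R n
      - ip (K y) v w *\<^sub>R (N u - Gam K y u n)" for u v w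
  proof -
    have 1: "fd (\<lambda>y. Gam Kb y v w) y = fd (\<lambda>y. Gam K y v w + fd s y v *\<^sub>R w + fd s y w *\<^sub>R v
        - ip (K y) v w *\<^sub>R grad K s y) y"
      by (rule fd_cong[OF open_S y Gam_conformal])
    have "fd (\<lambda>y. Gam Kb y v w) y u = fd (\<lambda>y. Gam K y v w) y u + fd (\<lambda>y. fd s y v) y u *\<^sub>R w
        + fd (\<lambda>y. fd s y w) y u *\<^sub>R v
        - (ip (K y) v w *\<^sub>R fd (grad K s) y u + fd (\<lambda>y. ip (K y) v w) y u *\<^sub>R n)"
      unfolding 1 n_def
      by (simp add: fd_add[of T] fd_diff[of T] fd_scaleR[of T] smooth_on_add smooth_on_scaleR
          smooth_on_const smooth_ip_const smooth_grad smooth_s smooth_ds smooth_Gam_const y open_S)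
    then show ?thesis
      unfolding dn dds metric_compatible[OF y] by (simp only: diff_diff_add add.commute)
  qed
  note ds = linear_add[OF linear_ds[OF y]] linear_diff[OF linear_ds[OF y]] linear_scale[OF linear_ds[OF y]]
  have E: "ip (K y) (fd (\<lambda>y. Gam Kb y v w) y u + Gam Kb y u (Gam Kb y v w)) z
      = ip (K y) (fd (\<lambda>y. Gam K y v w) y u + Gam K y u (Gam K y v w)) z
      + (Hess K s y u v + fd s y (Gam K y u v)) * ip (K y) w z
      + (Hess K s y u w + fd s y (Gam K y u w)) * ip (K y) v z
      - (ip (K y) (Gam K y u v) w + ip (K y) v (Gam K y u w)) * fd s y z
      - ip (K y) v w * Hess K s y u z
      + fd s y v * ip (K y) (Gam K y u w) z + fd s y w * ip (K y) (Gam K y u v) z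
      + fd s y u * (ip (K y) (Gam K y v w) z + fd s y v * ip (K y) w z + fd s y w * ip (K y) v z
          - ip (K y) v w * fd s y z)
      + (fd s y (Gam K y v w) + 2 * fd s y v * fd s y w - ip (K y) v w * fd s y n) * ip (K y) u z
      - (ip (K y) u (Gam K y v w) + fd s y v * ip (K y) u w + fd s y w * ip (K y) u v
          - ip (K y) v w * fd s y u) * fd s y z" for u v w
    unfolding dG Gam_conformal[OF y] n_def[symmetric] Gam_simps ip_simps ds ipn ipN real_scaleR_def
    by algebra
  have R: "ip (K y) (Riem H y u v w) z = ip (K y) (fd (\<lambda>y. Gam H y v w) y u + Gam H y u (Gam H y v w)) z
      - ip (K y) (fd (\<lambda>y. Gam H y u w) y v + Gam H y v (Gam H y u w)) z" for H
    by (simp add: Riem_Gam ip_simps)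
  \<comment> \<open>Symmetric arguments are put into one fixed order, so that \<open>algebra\<close>
    meets equal quantities as equal atoms.\<close>
  have sym: "ip (K y) v u = ip (K y) u v" "Gam K y v u = Gam K y u v" "Hess K s y v u = Hess K s y u v"
    "ip (K y) v (Gam K y u w) = ip (K y) (Gam K y u w) v" "ip (K y) u (Gam K y v w) = ip (K y) (Gam K y v w) u"
    "ip (K y) w u = ip (K y) u w" "ip (K y) w v = ip (K y) v w"
    using ip_commute[OF y] Gam_commute[OF y] Hess_commute[OF smooth_s y] by metis+
  show ?thesis
    unfolding R E schouten_def n_def[symmetric] ipn sym
    by algebra
qed

lemma Riem_flat:
  assumes "y \<in> T" "\<And>u v w. Riem Kb y u v w = 0"
  shows "ip (K y) (Riem K y u v w) z = schouten y v w * ip (K y) u z - schouten y u w * ip (K y) v z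
    + ip (K y) v w * schouten y u z - ip (K y) u w * schouten y v z"
  using Riem_conformal[OF assms(1), of u v w z] assms(2) by (simp add: ip_simps)

lemma bilinear_schouten:
  assumes "y \<in> T"
  shows "bilinear (schouten y)"
proof -
  note H = bilinear_Hess[OF smooth_s assms]
  note simps = bilinear_ladd[OF H] bilinear_radd[OF H] bilinear_lmul[OF H] bilinear_rmul[OF H]
    linear_add[OF linear_ds[OF assms]] linear_scale[OF linear_ds[OF assms]] ip_simps
  show ?thesis
    unfolding bilinear_def schouten_def
    by (auto intro!: linearI simp: simps algebra_simps add_divide_distrib)
qed

text \<open>The square of the differential has trace |grad \<sigma>|^2, and the metric has the
  dimension as its trace; half of the latter minus one is the coefficient.\<close>

lemma gtrace_schouten:
  assumes y: "y \<in> T"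
  shows "gtrace (K y) (schouten y) = Laplace K s y
    + (real CARD('n) / 2 - 1) * ip (K y) (grad K s y) (grad K s y)"
proof -
  have "gtrace (K y) (schouten y) = Laplace K s y - gtrace (K y) (\<lambda>u v. fd s y u *\<^sub>R fd s y v)
      + gtrace (K y) (\<lambda>u v. (1/2) * ip (K y) (grad K s y) (grad K s y) * ip (K y) u v)"
    unfolding schouten_def[abs_def] gtrace_add gtrace_diff Laplace_def by simp
  also have "gtrace (K y) (\<lambda>u v. fd s y u *\<^sub>R fd s y v) = ip (K y) (grad K s y) (grad K s y)"
    by (simp only: gtrace_grad1[OF y smooth_s linear_ds[OF y]] ip_grad[OF y smooth_s])
  finally show ?thesis
    by (simp only: gtrace_cmult gtrace_metric[OF y]) (simp add: algebra_simps)
qed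

end

section \<open>Hypersurfaces\<close>

locale hypersurface = map_into_riemannian_domain T K U F + dom: riemannian_domain U G
  for T :: "(real ^ 'n::finite) set" and K and U :: "(real ^ 'm::finite) set" and F and G +
  fixes X :: "real ^ 'm \<Rightarrow> real ^ 'n"
  assumes codim: "CARD('n) = CARD('m) + 1"
    and smooth_X: "smooth_on U X"
    and isometric: "x \<in> U \<Longrightarrow> ip (K (F x)) (fd F x u) (fd F x v) = ip (G x) u v"
    and unit_X: "x \<in> U \<Longrightarrow> ip (K (F x)) (X x) (X x) = 1"
    and normal_X: "x \<in> U \<Longrightarrow> ip (K (F x)) (X x) (fd F x u) = 0"
begin

sublocale id_U: map_into_riemannian_domain U G U "\<lambda>x. x"
  by unfold_locales (auto simp: dom.open_S smooth_on_id)

abbreviation A :: "real ^ 'm \<Rightarrow> real ^ 'm \<Rightarrow> real ^ 'm" where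
  "A \<equiv> shape K F X"

lemma normal_X': "x \<in> U \<Longrightarrow> ip (K (F x)) (fd F x u) (X x) = 0"
  using normal_X ip_commute[OF F_in] by metis

text \<open>The map from pairs \<open>(w, a)\<close> is injective, by isometry and normality, and
  the codimension makes source and target equally large.\<close>

lemma decompose:
  assumes x: "x \<in> U"
  obtains w a where "V = fd F x w + a *\<^sub>R X x"
proof -
  define L where "L = (\<lambda>p :: (real ^ 'm) \<times> real. fd F x (fst p) + snd p *\<^sub>R X x)"
  have lin: "linear L"
    unfolding L_def
    by (rule linearI) (simp_all add: linear_add[OF linear_dF[OF x]] linear_scale[OF linear_dF[OF x]]
        algebra_simps)
  have "p = 0" if "L p = 0" for p
  proof -
    have "ip (K (F x)) (L p) (fd F x u) = 0" "ip (K (F x)) (L p) (X x) = 0" for u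
      using that by (simp_all add: ip_simps)
    then have "ip (G x) (fst p) u = ip (G x) 0 u" "snd p = 0" for u
      by (simp_all add: L_def ip_simps isometric[OF x] unit_X[OF x] normal_X[OF x] normal_X'[OF x])
    then show ?thesis
      using dom.ip_eqI[OF x, of "fst p" 0] by (simp add: prod_eq_iff)
  qed
  then have "inj L"
    using linear_injective_0[OF lin] by blast
  then have "dim (range L) = DIM((real ^ 'm) \<times> real)"
    using dim_image_eq[OF lin, of UNIV] by (simp add: inj_on_subset)
  then have "dim (range L) = DIM(real ^ 'n)"
    by (simp add: codim)
  then have "range L = UNIV"
    using subspace_dim_equal[of "range L" UNIV] linear_subspace_image[OF lin] by simp
  then obtain p where "V = L p"
    by blast
  then show ?thesis
    using that[of "fst p" "snd p"] by (simp add: L_def)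
qed

lemma ambient_eqI:
  assumes x: "x \<in> U" and "\<And>u. ip (K (F x)) V (fd F x u) = ip (K (F x)) W (fd F x u)"
    and "ip (K (F x)) V (X x) = ip (K (F x)) W (X x)"
  shows "V = W"
proof (rule ip_eqI[OF F_in[OF x]])
  fix Z
  obtain w a where "Z = fd F x w + a *\<^sub>R X x"
    using decompose[OF x] .
  then show "ip (K (F x)) V Z = ip (K (F x)) W Z"
    using assms(2,3) by (simp add: ip_simps)
qed

text \<open>Discharges the definite description: two candidates have equal inner products with all
  tangent vectors, by isometry.\<close>

lemma tangential_eq:
  assumes x: "x \<in> U" and V: "V = fd F x w + a *\<^sub>R X x"
  shows "tangential K F x V = w"
  unfolding tangential_def
proof (rule the_equality)
  show "\<forall>u. ip (K (F x)) (V - fd F x w) (fd F x u) = 0"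
    by (simp add: V ip_simps normal_X[OF x])
  fix w'
  assume "\<forall>u. ip (K (F x)) (V - fd F x w') (fd F x u) = 0"
  then show "w' = w"
    by (intro dom.ip_eqI[OF x]) (simp add: V ip_simps normal_X[OF x] isometric[OF x])
qed

text \<open>Differentiating the constant square length of \<open>X\<close> shows that its derivative
  has no normal part; the tangential part is the shape operator, up to its sign.\<close>

lemma weingarten:
  assumes x: "x \<in> U"
  shows "D u X x = - fd F x (A x u)"
proof -
  obtain w a where wa: "D u X x = fd F x w + a *\<^sub>R X x"
    using decompose[OF x] .
  have "fd (\<lambda>x. ip (K (F x)) (X x) (X x)) x = fd (\<lambda>x. 1) x"
    by (rule fd_cong[OF open_U x unit_X])
  then have "ip (K (F x)) (D u X x) (X x) = 0"
    using fd_ip[OF smooth_X smooth_X x, of u] ip_commute[OF F_in[OF x], of "X x"] by simp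
  then have "a = 0"
    by (simp add: wa ip_simps normal_X'[OF x] unit_X[OF x])
  then show ?thesis
    using tangential_eq[OF x wa] by (simp add: shape_def wa linear_neg[OF linear_dF[OF x]])
qed

lemma ip_A_D: "x \<in> U \<Longrightarrow> ip (G x) (A x u) v = - ip (K (F x)) (D u X x) (fd F x v)"
  by (simp add: weingarten ip_simps isometric)

text \<open>A definite description shows no linearity; it is read off from the inner products in
  \<open>ip_A_D\<close>, which are linear through \<open>D\<close>.\<close>

lemma linear_A: "x \<in> U \<Longrightarrow> linear (A x)"
  using linear_D[OF smooth_X, of x]
  by (intro linearI dom.ip_eqI[of x])
    (simp_all add: ip_A_D ip_simps linear_add[of "\<lambda>u. D u X x"] linear_scale[of "\<lambda>u. D u X x"])

text \<open>Differentiate the orthogonality of \<open>X\<close> and \<open>fd F x v\<close>: the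
  derivative moves from the normal field to the tangent field.\<close>

lemma ip_A: "x \<in> U \<Longrightarrow> ip (G x) (A x u) v = ip (K (F x)) (D u (\<lambda>y. fd F y v) x) (X x)"
proof -
  assume x: "x \<in> U"
  have "fd (\<lambda>x. ip (K (F x)) (X x) (fd F x v)) x = fd (\<lambda>x. 0) x"
    by (rule fd_cong[OF open_U x normal_X])
  then show ?thesis
    using fd_ip[OF smooth_X smooth_on_fd_const[OF smooth_F] x, of v u]
      ip_commute[OF F_in[OF x], of "X x"] by (simp add: ip_A_D[OF x])
qed

lemma A_self_adjoint: "x \<in> U \<Longrightarrow> ip (G x) (A x u) v = ip (G x) u (A x v)"
  using ip_A[of x] D_dF_commute[of x u v] dom.ip_commute[of x u] by simp

text \<open>The components of \<open>A x u\<close> are recovered from its inner products with the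
  axis vectors by raising the index, which gives a formula made of smooth ingredients.\<close>

lemma smooth_A: "smooth_on U (\<lambda>x. A x u)"
proof (rule smooth_on_componentwise[OF open_U], rule smooth_on_cong[OF open_U])
  fix k
  show "smooth_on U (\<lambda>x. \<Sum>i\<in>UNIV. (- ip (K (F x)) (D u X x) (fd F x (axis i 1))) * matrix_inv (G x) $ k $ i)"
    by (intro smooth_on_sum smooth_on_mult smooth_on_minus smooth_ip smooth_D smooth_on_fd_const
        smooth_on_const smooth_F smooth_X dom.smooth_inv open_U)
  show "(\<Sum>i\<in>UNIV. (- ip (K (F x)) (D u X x) (fd F x (axis i 1))) * matrix_inv (G x) $ k $ i) = A x u $ k"
    if x: "x \<in> U" for x
  proof -
    have "A x u $ k = (\<Sum>i\<in>UNIV. ip (G x) (A x u) (axis i 1) *\<^sub>R dom.cobasis x i) $ k"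
      by (simp only: dom.cobasis_expand[OF x])
    then show ?thesis
      by (simp add: ip_A_D[OF x] dom.cobasis_def matrix_vector_mul_component inner_axis)
  qed
qed

text \<open>The tangential part of the induced connection is symmetric and metric, hence it is the
  Levi-Civita connection of \<open>G\<close>.\<close>

lemma gauss_const:
  assumes x: "x \<in> U"
  shows "D u (\<lambda>y. fd F y v) x = fd F x (Gam G x u v) + ip (G x) (A x u) v *\<^sub>R X x"
proof -
  have "\<exists>w a. D u (\<lambda>y. fd F y v) x = fd F x w + a *\<^sub>R X x" for u v
    using decompose[OF x] by metis
  then obtain C a where C: "D u (\<lambda>y. fd F y v) x = fd F x (C u v) + a u v *\<^sub>R X x" for u v
    by metis
  have ipC: "ip (K (F x)) (D u (\<lambda>y. fd F y v) x) (fd F x w) = ip (G x) (C u v) w" for u v w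
    by (simp add: C ip_simps isometric[OF x] normal_X[OF x])
  have "C u v = Gam G x u v" for u v
  proof (rule dom.Gam_unique[OF x])
    show "C u v = C v u" for u v
      by (rule dom.ip_eqI[OF x]) (simp add: ipC[symmetric] D_dF_commute[OF x, of u v])
    fix u v w
    have "fd (\<lambda>y. ip (G y) u v) x = fd (\<lambda>y. ip (K (F y)) (fd F y u) (fd F y v)) x"
      by (rule fd_cong[OF open_U x]) (simp add: isometric)
    then show "fd (\<lambda>y. ip (G y) u v) x w = ip (G x) (C w u) v + ip (G x) u (C w v)"
      using ip_commute[OF F_in[OF x], of "fd F x u"] dom.ip_commute[OF x, of u]
      by (simp add: fd_ip[OF smooth_on_fd_const[OF smooth_F] smooth_on_fd_const[OF smooth_F] x] ipC)
  qed
  moreover have "a u v = ip (G x) (A x u) v"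
    by (simp add: ip_A[OF x] C ip_simps normal_X'[OF x] unit_X[OF x])
  ultimately show ?thesis
    by (simp add: C)
qed

text \<open>A field \<open>W\<close> with varying components adds only the image of its own
  derivative to the constant case.\<close>

lemma gauss:
  assumes x: "x \<in> U" and W: "smooth_on U W"
  shows "D u (\<lambda>y. fd F y (W y)) x
    = fd F x (fd W x u + Gam G x u (W x)) + ip (G x) (A x u) (W x) *\<^sub>R X x"
  using fd_linear_family[OF open_U x linear_dF smooth_on_fd_const[OF smooth_F] W, of u]
    gauss_const[OF x, of u "W x"]
  by (simp add: nabla_along_def linear_add[OF linear_dF[OF x]])

section \<open>Tension field, Codazzi equation and second derivatives of the tension field\<close>

definition tr_A :: "real ^ 'm \<Rightarrow> real" where
  "tr_A x = trace (matrix (A x))"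

lemma smooth_tr_A: "smooth_on U tr_A"
  unfolding tr_A_def[abs_def] trace_def matrix_def vec_lambda_beta
  by (intro smooth_on_sum smooth_on_vec_nth smooth_A open_U)

lemma tension_eq:
  assumes x: "x \<in> U"
  shows "tension G K F x = tr_A x *\<^sub>R X x"
proof -
  have "second_fund G K F x = (\<lambda>u v. ip (G x) (A x u) v *\<^sub>R X x)"
    by (intro ext) (simp add: second_fund_def gauss_const[OF x])
  then have "tension G K F x = gtrace (G x) (\<lambda>u v. ip (G x) (A x u) v) *\<^sub>R X x"
    using gtrace_linear[of "\<lambda>r. r *\<^sub>R X x" "G x" "\<lambda>u v. ip (G x) (A x u) v"]
    by (simp add: tension_def linear_scale_left)
  then show ?thesis
    by (simp add: dom.gtrace_endo[OF x] tr_A_def)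
qed

text \<open>The covariant derivative of the endomorphism field \<open>A\<close> in direction
  \<open>u\<close>, applied to \<open>v\<close> extended with constant components.\<close>

definition nabla_A :: "real ^ 'm \<Rightarrow> real ^ 'm \<Rightarrow> real ^ 'm \<Rightarrow> real ^ 'm" where
  "nabla_A x u v = fd (\<lambda>y. A y v) x u + Gam G x u (A x v) - A x (Gam G x u v)"

text \<open>The ambient curvature applied to \<open>X\<close> is the commutator of two derivatives
  of \<open>X\<close>. Expanded by Weingarten and Gauss, its normal part is symmetric in
  \<open>u\<close> and \<open>v\<close> and drops out.\<close>

lemma codazzi:
  assumes x: "x \<in> U"
  shows "fd F x (nabla_A x u v - nabla_A x v u) = - Riem K (F x) (fd F x u) (fd F x v) (X x)"
proof -
  have "D u (D v X) x = fd F x (- fd (\<lambda>y. A y v) x u - Gam G x u (A x v)) - ip (G x) (A x u) (A x v) *\<^sub>R X x"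
    for u v
  proof -
    have "D u (D v X) x = D u (\<lambda>y. fd F y (- A y v)) x"
      by (rule nabla_along_cong[OF open_U x]) (simp add: weingarten linear_neg[OF linear_dF])
    also have "\<dots> = fd F x (fd (\<lambda>y. - A y v) x u + Gam G x u (- A x v)) + ip (G x) (A x u) (- A x v) *\<^sub>R X x"
      by (rule gauss[OF x smooth_on_minus[OF open_U smooth_A]])
    finally show ?thesis
      by (simp add: fd_minus[OF smooth_A x] Gam_simps ip_simps)
  qed
  from D_D_commute[OF smooth_X x, of u v, unfolded this]
  have "Riem K (F x) (fd F x u) (fd F x v) (X x)
    = fd F x (- fd (\<lambda>y. A y v) x u - Gam G x u (A x v)) - fd F x (- fd (\<lambda>y. A y u) x v - Gam G x v (A x u))"
    using dom.ip_commute[OF x, of "A x u" "A x v"] by simp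
  then show ?thesis
    using dom.Gam_commute[OF x, of u v]
    by (simp add: nabla_A_def linear_diff[OF linear_dF[OF x]] linear_add[OF linear_dF[OF x]]
        linear_neg[OF linear_dF[OF x]])
qed

text \<open>Differentiate the self-adjointness of \<open>A\<close> for constant arguments and use it
  once more for the \<open>Gam\<close> terms.\<close>

lemma nabla_A_self_adjoint:
  assumes x: "x \<in> U"
  shows "ip (G x) (nabla_A x u v) w = ip (G x) v (nabla_A x u w)"
proof -
  have "fd (\<lambda>y. ip (G y) (A y v) w) x = fd (\<lambda>y. ip (G y) v (A y w)) x"
    by (rule fd_cong[OF open_U x]) (rule A_self_adjoint)
  then show ?thesis
    using id_U.fd_ip[OF smooth_A smooth_on_const x, of v w u] id_U.fd_ip[OF smooth_on_const smooth_A x, of v w u]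
      A_self_adjoint[OF x]
    by (simp add: nabla_A_def nabla_along_def ip_simps)
qed

text \<open>The connection enters through the commutator of \<open>Gam G x u\<close> and
  \<open>A x\<close>, which has trace zero.\<close>

lemma trace_nabla_A:
  assumes x: "x \<in> U"
  shows "trace (matrix (nabla_A x u)) = fd tr_A x u"
proof -
  have "fd tr_A x u = (\<Sum>i\<in>UNIV. fd (\<lambda>y. A y (axis i 1)) x u $ i)"
    unfolding tr_A_def[abs_def] trace_def matrix_def vec_lambda_beta
    by (simp add: fd_sum[of _ U] fd_bounded_linear[OF bounded_linear_vec_nth smooth_A]
        smooth_on_vec_nth smooth_A open_U x)
  moreover have "(\<Sum>i\<in>UNIV. Gam G x u (A x (axis i 1)) $ i) = (\<Sum>i\<in>UNIV. A x (Gam G x u (axis i 1)) $ i)"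
  proof -
    have l: "linear (Gam G x u)"
      using bilinear_Gam unfolding bilinear_def by blast
    have "trace (matrix (Gam G x u \<circ> A x)) = trace (matrix (A x \<circ> Gam G x u))"
      using trace_mul_sym[of "matrix (Gam G x u)" "matrix (A x)"]
      by (simp add: matrix_compose[OF linear_A[OF x] l] matrix_compose[OF l linear_A[OF x]])
    then show ?thesis
      by (simp add: trace_def matrix_def)
  qed
  ultimately show ?thesis
    by (simp add: nabla_A_def trace_def matrix_def sum.distrib sum_subtractf)
qed

text \<open>The second derivative meets \<open>dF\<close> applied to \<open>A\<close>, where the
  Gauss formula creates a new normal term. Subtracting the derivative along
  \<open>Gam G x u v\<close> completes the second derivative of \<open>tr_A\<close> to
  \<open>Hess\<close> and that of \<open>A\<close> to \<open>nabla_A\<close>.\<close>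

lemma D_D_tension:
  assumes x: "x \<in> U"
  shows "D u (D v (tension G K F)) x - D (Gam G x u v) (tension G K F) x
    = (Hess G tr_A x u v - tr_A x * ip (G x) (A x u) (A x v)) *\<^sub>R X x
      - fd F x (fd tr_A x v *\<^sub>R A x u + fd tr_A x u *\<^sub>R A x v + tr_A x *\<^sub>R nabla_A x u v)"
proof -
  have 1: "D w (tension G K F) y = fd tr_A y w *\<^sub>R X y - tr_A y *\<^sub>R fd F y (A y w)" if "y \<in> U" for y w
  proof -
    have "D w (tension G K F) y = D w (\<lambda>y. tr_A y *\<^sub>R X y) y"
      by (rule nabla_along_cong[OF open_U that tension_eq])
    then show ?thesis
      by (simp add: D_scaleR[OF smooth_tr_A smooth_X that] weingarten[OF that])
  qed
  have "D u (D v (tension G K F)) x = D u (\<lambda>y. fd tr_A y v *\<^sub>R X y - tr_A y *\<^sub>R fd F y (A y v)) x"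
    by (rule nabla_along_cong[OF open_U x 1])
  also have "\<dots> = D u (\<lambda>y. fd tr_A y v *\<^sub>R X y) x - D u (\<lambda>y. tr_A y *\<^sub>R fd F y (A y v)) x"
    by (intro D_diff x smooth_on_scaleR open_U smooth_on_fd_const smooth_tr_A smooth_X smooth_dF smooth_A)
  also have "D u (\<lambda>y. fd tr_A y v *\<^sub>R X y) x
      = fd (\<lambda>y. fd tr_A y v) x u *\<^sub>R X x - fd tr_A x v *\<^sub>R fd F x (A x u)"
    by (simp add: D_scaleR[OF smooth_on_fd_const[OF smooth_tr_A] smooth_X x] weingarten[OF x])
  also have "D u (\<lambda>y. tr_A y *\<^sub>R fd F y (A y v)) x = fd tr_A x u *\<^sub>R fd F x (A x v)
      + tr_A x *\<^sub>R (fd F x (fd (\<lambda>y. A y v) x u + Gam G x u (A x v)) + ip (G x) (A x u) (A x v) *\<^sub>R X x)"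
    by (simp add: D_scaleR[OF smooth_tr_A smooth_dF[OF smooth_A] x] gauss[OF x smooth_A])
  finally show ?thesis
    by (simp add: 1[OF x] Hess_def nabla_A_def linear_add[OF linear_dF[OF x]]
        linear_diff[OF linear_dF[OF x]] linear_scale[OF linear_dF[OF x]] algebra_simps)
qed

text \<open>For an orthonormal frame adapted to the hypersurface this is immediate. Here each
  ambient dual vector is expanded in the tangent vectors \<open>?e j\<close> and the normal.\<close>

lemma gtrace_split:
  assumes x: "x \<in> U" and B: "bilinear B"
  shows "gtrace (K (F x)) B = gtrace (G x) (\<lambda>u v. B (fd F x u) (fd F x v)) + B (X x) (X x)"
proof -
  note y = F_in[OF x]
  have linB: "linear (B u)" "linear (\<lambda>u. B u v)" for u v
    using B unfolding bilinear_def by auto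
  let ?c = "cobasis (F x)" and ?e = "\<lambda>j. fd F x (axis j 1)" and ?E = "\<lambda>j. fd F x (dom.cobasis x j)"
  \<comment> \<open>Inner products with \<open>?c i\<close> read off the \<open>i\<close>-th
    component. Applied to \<open>X x\<close> and to \<open>?E j\<close>, this gives the coefficients
    of \<open>?c i\<close>.\<close>
  have ce: "?c i = (\<Sum>j\<in>UNIV. ?E j $ i *\<^sub>R ?e j) + X x $ i *\<^sub>R X x" for i
  proof -
    obtain w a where wa: "?c i = fd F x w + a *\<^sub>R X x"
      using decompose[OF x] .
    have "V $ i = ip (K (F x)) (fd F x w + a *\<^sub>R X x) V" for V
      using ip_cobasis[OF y, of V i] ip_commute[OF y] by (simp add: wa)
    then have "X x $ i = a" "?E j $ i = w $ j" for j
      by (simp_all add: ip_simps normal_X'[OF x] normal_X[OF x] unit_X[OF x] isometric[OF x] dom.ip_cobasis[OF x])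
    then show ?thesis
      by (simp add: wa linear_expand_axis[OF linear_dF[OF x], of w])
  qed
  have "gtrace (K (F x)) B = (\<Sum>i\<in>UNIV. B (axis i 1) (?c i))"
    by (rule gtrace_cobasis[OF y linB(1)])
  also have "\<dots> = (\<Sum>i\<in>UNIV. (\<Sum>j\<in>UNIV. ?E j $ i *\<^sub>R B (axis i 1) (?e j)) + X x $ i *\<^sub>R B (axis i 1) (X x))"
    by (subst ce) (simp add: linear_add[OF linB(1)] linear_sum[OF linB(1)] linear_scale[OF linB(1)])
  also have "\<dots> = (\<Sum>j\<in>UNIV. \<Sum>i\<in>UNIV. ?E j $ i *\<^sub>R B (axis i 1) (?e j)) + (\<Sum>i\<in>UNIV. X x $ i *\<^sub>R B (axis i 1) (X x))"
    by (subst sum.swap) (simp add: sum.distrib)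
  also have "\<dots> = (\<Sum>j\<in>UNIV. B (?E j) (?e j)) + B (X x) (X x)"
    by (simp only: linear_expand_axis[OF linB(2), symmetric])
  also have "(\<Sum>j\<in>UNIV. B (?E j) (?e j)) = gtrace (G x) (\<lambda>u v. B (fd F x v) (fd F x u))"
    using linear_compose[OF linear_dF[OF x] linB(2)]
    by (subst dom.gtrace_cobasis[OF x]) (auto simp: o_def)
  \<comment> \<open>The slots of \<open>B\<close> came out exchanged; symmetry of the inverse Gram
    matrix exchanges them back.\<close>
  also have "\<dots> = gtrace (G x) (\<lambda>u v. B (fd F x u) (fd F x v))"
    using linear_compose[OF linear_dF[OF x] linB(2)]
    by (simp add: gtrace_def, subst sum.swap) (simp add: dom.inv_commute[OF x])
  finally show ?thesis .
qed

end

section \<open>Hypersurfaces of conformally flat spaces\<close>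

locale flat_hypersurface = hypersurface T K U F G X + conformal_metrics T K Kb s
  for T :: "(real ^ 'n::finite) set" and K and U :: "(real ^ 'm::finite) set" and F G X Kb s +
  assumes flat: "y \<in> T \<Longrightarrow> Riem Kb y u v w = 0"
begin

abbreviation xis :: "real ^ 'm \<Rightarrow> real" where
  "xis \<equiv> \<lambda>z. fd s (F z) (X z)"

abbreviation sM :: "real ^ 'm \<Rightarrow> real" where
  "sM \<equiv> \<lambda>z. s (F z)"

lemma smooth_xis: "smooth_on U xis"
  by (rule smooth_on_fd[OF open_U F_image smooth_s smooth_F smooth_X])

lemma smooth_sM: "smooth_on U sM"
  by (rule smooth_on_compose[OF open_U F_image smooth_s smooth_F])

text \<open>Differentiating the normal derivative of \<sigma> along \<open>w\<close> gives the mixed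
  Hessian and, by Weingarten, a term with \<open>A x w\<close>, which self-adjointness turns into
  \<open>A\<close> of the gradient. The metric part of \<open>schouten\<close> vanishes by
  normality.\<close>

lemma schouten_mixed:
  assumes x: "x \<in> U"
  shows "schouten (F x) (X x) (fd F x w)
    = ip (G x) (grad G xis x - xis x *\<^sub>R grad G sM x + A x (grad G sM x)) w"
proof -
  note y = F_in[OF x]
  have dsM: "fd sM x u = fd s (F x) (fd F x u)" for u
    by (rule fd_compose[OF smooth_s smooth_F x y])
  have "fd xis x w = fd (\<lambda>z. fd s (F z) (X x)) x w + fd s (F x) (fd X x w)"
    by (rule fd_linear_family[OF open_U x linear_ds[OF F_in] _ smooth_X])
      (auto intro: smooth_on_compose[OF open_U F_image smooth_ds smooth_F])
  also have "fd (\<lambda>z. fd s (F z) (X x)) x w = fd (\<lambda>y. fd s y (X x)) (F x) (fd F x w)"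
    by (rule fd_compose[OF smooth_ds smooth_F x y])
  also have "\<dots> = Hess K s (F x) (fd F x w) (X x) + fd s (F x) (Gam K (F x) (fd F x w) (X x))"
    by (simp add: Hess_def)
  finally have "fd xis x w = Hess K s (F x) (fd F x w) (X x) + fd s (F x) (D w X x)"
    by (simp add: nabla_along_def linear_add[OF linear_ds[OF y]])
  then have "Hess K s (F x) (X x) (fd F x w) = fd xis x w + fd sM x (A x w)"
    by (simp add: Hess_commute[OF smooth_s y, of "X x"] weingarten[OF x] linear_neg[OF linear_ds[OF y]] dsM)
  then show ?thesis
    using A_self_adjoint[OF x, of "grad G sM x" w]
    by (simp add: schouten_def normal_X[OF x] ip_simps dom.ip_grad[OF x] smooth_xis smooth_sM dsM)
qed

lemma ip_bitension:
  assumes x: "x \<in> U"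
  shows "ip (K (F x)) (bitension G K F x) Z
    = gtrace (G x) (\<lambda>u v. ip (K (F x)) ((Hess G tr_A x u v - tr_A x * ip (G x) (A x u) (A x v)) *\<^sub>R X x
      - fd F x (fd tr_A x v *\<^sub>R A x u + fd tr_A x u *\<^sub>R A x v + tr_A x *\<^sub>R nabla_A x u v)) Z)
    - gtrace (G x) (\<lambda>u v. ip (K (F x)) (Riem K (F x) (fd F x u) (tr_A x *\<^sub>R X x) (fd F x v)) Z)"
proof -
  have l: "linear (\<lambda>V. ip (K (F x)) V Z)"
    using bilinear_ip unfolding bilinear_def by blast
  show ?thesis
    unfolding bitension_def D_D_tension[OF x] tension_eq[OF x] gtrace_linear[OF l]
    by (rule bilinear_lsub[OF bilinear_ip])
qed

lemma bitension_normal: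
  assumes x: "x \<in> U"
  shows "ip (K (F x)) (bitension G K F x) (X x)
    = Laplace G tr_A x - tr_A x * shape_norm2 K F X x
      + tr_A x * (Laplace K s (F x) + (real CARD('m) - 1) * (Hess K s (F x) (X x) (X x) - (xis x)\<^sup>2
          + ip (K (F x)) (grad K s (F x)) (grad K s (F x))))"
proof -
  note y = F_in[OF x]
  note bs = bilinear_schouten[OF y]
  have R: "ip (K (F x)) (Riem K (F x) (fd F x u) (tr_A x *\<^sub>R X x) (fd F x v)) (X x)
    = - tr_A x * (schouten (F x) (fd F x u) (fd F x v) + schouten (F x) (X x) (X x) * ip (G x) u v)" for u v
    by (simp add: Riem_flat[OF y flat[OF y]] ip_simps normal_X[OF x] normal_X'[OF x] unit_X[OF x]
        isometric[OF x] bilinear_lmul[OF bs] algebra_simps)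
  have AA: "gtrace (G x) (\<lambda>u v. ip (G x) (A x u) (A x v)) = shape_norm2 K F X x"
    using dom.gtrace_endo[OF x, of "A x \<circ> A x"] A_self_adjoint[OF x]
    by (simp add: shape_norm2_def matrix_compose[OF linear_A[OF x] linear_A[OF x]])
  have "ip (K (F x)) (bitension G K F x) (X x) = Laplace G tr_A x - tr_A x * shape_norm2 K F X x
      + tr_A x * (gtrace (K (F x)) (schouten (F x)) + (real CARD('m) - 1) * schouten (F x) (X x) (X x))"
    unfolding ip_bitension[OF x] R gtrace_cmult gtrace_add dom.gtrace_metric[OF x] Laplace_def
    by (simp add: ip_simps normal_X'[OF x] unit_X[OF x] gtrace_diff gtrace_cmult AA dom.gtrace_metric[OF x]
        gtrace_split[OF x bs] algebra_simps)
  then show ?thesis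
    unfolding gtrace_schouten[OF y] schouten_def
    by (simp add: codim unit_X[OF x] power2_eq_square field_simps)
qed

text \<open>The trace of the Codazzi equation: by self-adjointness of \<open>nabla_A x u\<close> the divergence of \<open>A\<close>
  differs from the derivative of its trace by a curvature term.\<close>

lemma gtrace_nabla_A:
  assumes x: "x \<in> U"
  shows "gtrace (G x) (\<lambda>u v. ip (G x) (nabla_A x u v) w)
    = fd tr_A x w - (real CARD('m) - 1) * schouten (F x) (X x) (fd F x w)"
proof -
  note y = F_in[OF x]
  have s: "schouten (F x) a b = schouten (F x) b a" for a b
    using Hess_commute[OF smooth_s y] ip_commute[OF y] by (simp add: schouten_def)
  have "ip (G x) (nabla_A x u v) w = ip (G x) (nabla_A x w u) v
      - (schouten (F x) (fd F x w) (X x) * ip (G x) u v - ip (G x) w v *\<^sub>R schouten (F x) (fd F x u) (X x))"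
    for u v
  proof -
    \<comment> \<open>Self-adjointness exchanges \<open>v\<close> and \<open>w\<close>, so that
      Codazzi can make \<open>w\<close> the direction of differentiation; the trace over
      \<open>u\<close> and \<open>v\<close> then falls on \<open>nabla_A x w\<close>.\<close>
    have "ip (G x) (nabla_A x u v) w = ip (G x) (nabla_A x u w) v"
      by (simp only: nabla_A_self_adjoint[OF x] dom.ip_commute[OF x, of v])
    also have "\<dots> = ip (G x) (nabla_A x w u) v + ip (G x) (nabla_A x u w - nabla_A x w u) v"
      by (simp add: ip_simps)
    also have "ip (G x) (nabla_A x u w - nabla_A x w u) v
        = - ip (K (F x)) (Riem K (F x) (fd F x u) (fd F x w) (X x)) (fd F x v)"
      unfolding isometric[OF x, symmetric] codazzi[OF x] by (rule bilinear_lneg[OF bilinear_ip])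
    also have "\<dots> = - (schouten (F x) (fd F x w) (X x) * ip (G x) u v
        - ip (G x) w v *\<^sub>R schouten (F x) (fd F x u) (X x))"
      by (simp add: Riem_flat[OF y flat[OF y]] normal_X'[OF x] isometric[OF x])
    finally show ?thesis by simp
  qed
  moreover have "linear (\<lambda>u. schouten (F x) (fd F x u) (X x))"
    using bilinear_schouten[OF y] linear_compose[OF linear_dF[OF x], of "\<lambda>V. schouten (F x) V (X x)"]
    by (simp add: bilinear_def o_def)
  ultimately have "gtrace (G x) (\<lambda>u v. ip (G x) (nabla_A x u v) w) = fd tr_A x w
      - (schouten (F x) (fd F x w) (X x) * real CARD('m) - schouten (F x) (fd F x w) (X x))"
    by (simp only: gtrace_diff gtrace_cmult dom.gtrace_eval1[OF x] dom.gtrace_metric[OF x]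
        dom.gtrace_endo[OF x, of "nabla_A x w"] trace_nabla_A[OF x])
  then show ?thesis
    by (simp add: s[of "X x"] algebra_simps)
qed

lemma bitension_tangential:
  assumes x: "x \<in> U"
  shows "ip (K (F x)) (bitension G K F x) (fd F x w)
    = - ip (G x) (2 *\<^sub>R A x (grad G tr_A x) + tr_A x *\<^sub>R grad G tr_A x
        - (2 * (real CARD('m) - 1) * tr_A x) *\<^sub>R
          (grad G xis x - xis x *\<^sub>R grad G sM x + A x (grad G sM x))) w"
proof -
  note y = F_in[OF x]
  note bs = bilinear_schouten[OF y]
  have R: "ip (K (F x)) (Riem K (F x) (fd F x u) (tr_A x *\<^sub>R X x) (fd F x v)) (fd F x w)
    = tr_A x * (ip (G x) u w *\<^sub>R schouten (F x) (X x) (fd F x v)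
        - schouten (F x) (X x) (fd F x w) * ip (G x) u v)" for u v
    by (simp add: Riem_flat[OF y flat[OF y]] ip_simps normal_X[OF x] isometric[OF x]
        bilinear_lmul[OF bs] algebra_simps)
  have l: "linear (\<lambda>v. schouten (F x) (X x) (fd F x v))"
    using bs linear_compose[OF linear_dF[OF x], of "schouten (F x) (X x)"]
    by (simp add: bilinear_def o_def)
  have gR: "gtrace (G x) (\<lambda>u v. ip (K (F x)) (Riem K (F x) (fd F x u) (tr_A x *\<^sub>R X x) (fd F x v)) (fd F x w))
      = - (real CARD('m) - 1) * tr_A x * schouten (F x) (X x) (fd F x w)"
    unfolding R gtrace_cmult gtrace_diff dom.gtrace_metric[OF x] dom.gtrace_eval2[OF x l]
    by (simp add: algebra_simps)
  have lA: "linear (\<lambda>u. ip (G x) (A x u) w)"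
    using linear_compose[OF linear_A[OF x], of "\<lambda>u. ip (G x) u w"] bilinear_ip[of "G x"]
    by (simp add: bilinear_def o_def)
  \<comment> \<open>The factor \<open>- 1\<close> and the real \<open>*\<^sub>R\<close> give the
    summands the shapes that the trace lemmas match.\<close>
  have Q: "ip (K (F x)) (a *\<^sub>R X x - fd F x (fd tr_A x v *\<^sub>R A x u + fd tr_A x u *\<^sub>R A x v
        + tr_A x *\<^sub>R nabla_A x u v)) (fd F x w)
      = (- 1) * (fd tr_A x v *\<^sub>R ip (G x) (A x u) w + fd tr_A x u *\<^sub>R ip (G x) (A x v) w
        + tr_A x * ip (G x) (nabla_A x u v) w)" for a u v
    by (simp add: ip_simps normal_X[OF x] isometric[OF x])
  show ?thesis
    unfolding ip_bitension[OF x] gR Q gtrace_add gtrace_cmult dom.gtrace_grad1[OF x smooth_tr_A lA]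
      dom.gtrace_grad2[OF x smooth_tr_A lA] gtrace_nabla_A[OF x] schouten_mixed[OF x]
    by (simp add: ip_simps dom.ip_grad[OF x] smooth_tr_A smooth_xis smooth_sM algebra_simps)
qed

theorem bitension_eq_0_iff:
  assumes x: "x \<in> U"
  defines "H \<equiv> mean_curv K F X" and "m \<equiv> real CARD('m)"
  shows "bitension G K F x = 0 \<longleftrightarrow>
    Laplace G H x - H x * shape_norm2 K F X x
      + H x * (Laplace K s (F x) + (m - 1) * (Hess K s (F x) (X x) (X x) - (xis x)\<^sup>2
          + ip (K (F x)) (grad K s (F x)) (grad K s (F x)))) = 0 \<and>
    2 *\<^sub>R A x (grad G H x) + (m / 2) *\<^sub>R grad G (\<lambda>z. (H z)\<^sup>2) x
      - (2 * (m - 1) * H x) *\<^sub>R (grad G xis x - xis x *\<^sub>R grad G sM x + A x (grad G sM x)) = 0"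
    (is "_ \<longleftrightarrow> ?N = 0 \<and> ?V = 0")
proof -
  have m: "m > 0" by (simp add: m_def)
  have H: "H = (\<lambda>x. (1 / m) * tr_A x)"
    by (simp add: H_def m_def mean_curv_def[abs_def] tr_A_def)
  have smooth_H: "smooth_on U H"
    unfolding H by (rule smooth_on_mult[OF open_U smooth_on_const smooth_tr_A])
  have tr: "tr_A = (\<lambda>x. m * H x)"
    using m by (simp add: H)
  have N: "ip (K (F x)) (bitension G K F x) (X x) = m * ?N"
    unfolding bitension_normal[OF x] m_def[symmetric]
    by (simp add: tr dom.Laplace_cmult[OF smooth_H x] algebra_simps)
  \<comment> \<open>With \<open>tr_A\<close> equal to \<open>m\<close> times \<open>H\<close>, the
    gradient terms carry \<open>m * H x\<close> times the gradient of \<open>H\<close>, which is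
    \<open>m / 2\<close> times the gradient of the square.\<close>
  have V: "ip (K (F x)) (bitension G K F x) (fd F x w) = - m * ip (G x) ?V w" for w
    unfolding bitension_tangential[OF x] m_def[symmetric]
    by (simp add: tr dom.grad_cmult[OF smooth_H x] dom.grad_power2[OF smooth_H x]
        linear_scale[OF linear_A[OF x]] ip_simps algebra_simps)
  show ?thesis
  proof
    assume "bitension G K F x = 0"
    then have "m * ?N = 0" "m * ip (G x) ?V w = 0" for w
      using N V[of w] by (simp_all add: ip_simps)
    then show "?N = 0 \<and> ?V = 0"
      using m dom.ip_eqI[OF x, of ?V 0] by (simp add: ip_simps)
  next
    assume "?N = 0 \<and> ?V = 0"
    then show "bitension G K F x = 0"
      using N V by (intro ambient_eqI[OF x]) (simp_all add: ip_simps)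
  qed
qed

end

section \<open>Charts\<close>

lemma cinv_cmap:
  "smooth_manifold A \<Longrightarrow> c \<in> A \<Longrightarrow> p \<in> cdom c \<Longrightarrow> cinv c (cmap c p) = p"
  unfolding smooth_manifold_def homeomorphism_def by blast

lemma rep_cmap:
  "smooth_manifold A \<Longrightarrow> c \<in> A \<Longrightarrow> p \<in> cdom c \<Longrightarrow> rep c f (cmap c p) = f p"
  by (simp add: rep_def cinv_cmap)

lemma map_rep_cmap:
  "smooth_manifold A \<Longrightarrow> c \<in> A \<Longrightarrow> p \<in> cdom c \<Longrightarrow> map_rep c d \<phi> (cmap c p) = cmap d (\<phi> p)"
  by (simp add: map_rep_def cinv_cmap)

text \<open>A chart domain of M need not be mapped into a single chart of C, so all local work takes
  place on this part of it, which must be open for derivatives to make sense.\<close>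

lemma open_chart_preimage:
  assumes A: "smooth_manifold A" "c \<in> A" and B: "smooth_manifold B" "d \<in> B"
    and \<phi>: "continuous_on (carrier A) \<phi>"
  shows "open (cmap c ` {p \<in> cdom c. \<phi> p \<in> cdom d})" (is "open (_ ` ?W)")
proof -
  have c: "open (cdom c)" "open (cmap c ` cdom c)"
    "homeomorphism (cdom c) (cmap c ` cdom c) (cmap c) (cinv c)"
    and d: "open (cdom d)"
    using A B unfolding smooth_manifold_def by blast+
  have "continuous_on (cdom c) \<phi>"
    by (rule continuous_on_subset[OF \<phi>]) (use A in \<open>auto simp: carrier_def\<close>)
  then have "open (\<phi> -` cdom d \<inter> cdom c)"
    using continuous_on_open_vimage[OF c(1)] d by blast
  moreover have "?W = \<phi> -` cdom d \<inter> cdom c"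
    by auto
  ultimately have "openin (top_of_set (cdom c)) ?W"
    using c(1) by (simp add: openin_open_eq)
  then have "openin (top_of_set (cmap c ` cdom c)) (cmap c ` ?W)"
    by (rule homeomorphism_imp_open_map[OF c(3)])
  then show ?thesis
    using c(2) openin_open_eq by blast
qed

theorem theorem2p2:
  fixes AM :: "('p::{t2_space,second_countable_topology}, 'm::finite) chart set"
    and AC :: "('q::{t2_space,second_countable_topology}, 'n::finite) chart set"
    and g :: "('p, 'm) metric"
    and h hbar :: "('q, 'n) metric"
    and \<sigma> :: "'q \<Rightarrow> real"
    and \<phi> :: "'p \<Rightarrow> 'q"
    and \<xi> :: "('q, 'n) chart \<Rightarrow> 'p \<Rightarrow> real ^ 'n"
  assumes codim: "CARD('n) = CARD('m) + 1"
    and C: "smooth_manifold AC"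
    and flat: "flat_metric AC hbar"
    and sigma: "smooth_fun AC \<sigma>"
    and conformal: "\<forall>d\<in>AC. \<forall>q\<in>cdom d. h d q = exp (- 2 * \<sigma> q) *\<^sub>R hbar d q"
    and M: "smooth_manifold AM"
    and g: "riemannian_metric AM g"
    and phi: "isometric_immersion AM g AC h \<phi>"
    and xi: "unit_normal_field AM AC h \<phi> \<xi>"
  shows "biharmonic AM g AC h \<phi> \<longleftrightarrow>
    (\<forall>c\<in>AM. \<forall>d\<in>AC. \<forall>p\<in>cdom c. \<phi> p \<in> cdom d \<longrightarrow>
      (let G = rep c (g c); K = rep d (h d); F = map_rep c d \<phi>; X = rep c (\<xi> d);
           s = rep d \<sigma>; sM = rep c (\<sigma> \<circ> \<phi>); x = cmap c p; y = cmap d (\<phi> p);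
           m = real CARD('m);
           H = mean_curv K F X;
           A = shape K F X x;
           xis = (\<lambda>z. fd s (F z) (X z))
       in Laplace G H x - H x * shape_norm2 K F X x
            + H x * (Laplace K s y
                     + (m - 1) * (Hess K s y (X x) (X x) - (xis x)\<^sup>2
                                  + ip (K y) (grad K s y) (grad K s y))) = 0
        \<and> 2 *\<^sub>R A (grad G H x) + (m / 2) *\<^sub>R grad G (\<lambda>z. (H z)\<^sup>2) x
            - (2 * (m - 1) * H x) *\<^sub>R
                (grad G xis x - xis x *\<^sub>R grad G sM x + A (grad G sM x)) = 0))"
proof -
  let "_ \<longleftrightarrow> (\<forall>c\<in>AM. \<forall>d\<in>AC. \<forall>p\<in>cdom c. _ \<longrightarrow> ?E c d p)" = ?thesis
  have main: "bitension (rep c (g c)) (rep d (h d)) (map_rep c d \<phi>) (cmap c p) = 0 \<longleftrightarrow> ?E c d p"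
    if c: "c \<in> AM" and d: "d \<in> AC" and p: "p \<in> cdom c" "\<phi> p \<in> cdom d" for c d p
  proof -
    define T where "T = cmap d ` cdom d"
    define U where "U = cmap c ` {p \<in> cdom c. \<phi> p \<in> cdom d}"
    define G where "G = rep c (g c)"
    define K where "K = rep d (h d)"
    define Kb where "Kb = rep d (hbar d)"
    define F where "F = map_rep c d \<phi>"
    define X where "X = rep c (\<xi> d)"
    define s where "s = rep d \<sigma>"
    have \<phi>: "smooth_map AM AC \<phi>"
      using phi by (simp add: isometric_immersion_def)
    have hbar: "riemannian_metric AC hbar"
      using flat by (simp add: flat_metric_def)
    have T: "open T"
      using C d by (simp add: smooth_manifold_def T_def)
    have U: "open U"
      unfolding U_def using \<phi> by (intro open_chart_preimage[OF M c C d]) (simp add: smooth_map_def)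
    have U_sub: "U \<subseteq> cmap c ` cdom c"
      by (auto simp: U_def)
    have U_cases: thesis if "x \<in> U" "\<And>p. p \<in> cdom c \<Longrightarrow> \<phi> p \<in> cdom d \<Longrightarrow> x = cmap c p \<Longrightarrow> thesis" for x thesis
      using that by (auto simp: U_def)
    note rep = rep_cmap[OF M c] map_rep_cmap[OF M c] rep_cmap[OF C d]
    have smooth_s: "smooth_on T s"
      using sigma d by (simp add: smooth_fun_def T_def s_def)
    have smooth_Kb: "smooth_on T Kb"
      using hbar d by (simp add: riemannian_metric_def T_def Kb_def)
    have conf: "K y = exp (- 2 * s y) *\<^sub>R Kb y" if "y \<in> T" for y
      using that conformal d by (auto simp: T_def K_def Kb_def s_def rep)
    \<comment> \<open>Smoothness of \<open>h\<close>, and below its symmetry and positivity, are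
      inherited from \<open>hbar\<close> through the positive smooth conformal factor.\<close>
    have smooth_K: "smooth_on T K"
    proof (rule smooth_on_cong[OF T])
      show "smooth_on T (\<lambda>y. exp (- 2 * s y) *\<^sub>R Kb y)"
        by (intro smooth_on_scaleR T smooth_Kb smooth_on_compose[OF T subset_UNIV smooth_on_exp]
            smooth_on_mult smooth_on_const smooth_s)
    qed (simp add: conf)
    have Kb: "transpose (Kb y) = Kb y" "u \<noteq> 0 \<Longrightarrow> ip (Kb y) u u > 0" if "y \<in> T" for y u
      using that hbar d by (auto simp: T_def Kb_def rep riemannian_metric_def)
    have ip_K: "ip (K y) u v = exp (- 2 * s y) * ip (Kb y) u v" if "y \<in> T" for y u v
      by (simp add: conf[OF that] ip_def scaleR_matrix_vector_assoc[symmetric])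
    interpret flat_hypersurface T K U F G X Kb s
    proof unfold_locales
      show "transpose (K y) = K y" if "y \<in> T" for y
        using Kb(1)[OF that] by (simp add: conf[OF that] transpose_scalar)
      show "ip (K y) u u > 0" if "y \<in> T" "u \<noteq> 0" for y u
        using Kb(2)[OF that] by (simp add: ip_K that)
      show "smooth_on U F"
        using \<phi> c d by (simp add: smooth_map_def U_def F_def)
      show "F ` U \<subseteq> T"
        by (auto simp: U_def F_def T_def rep)
      show "smooth_on U G"
        using g c by (intro smooth_on_subset[OF _ U_sub]) (simp add: riemannian_metric_def G_def)
      show "transpose (G x) = G x" if "x \<in> U" for x
        using that g c by (auto simp: riemannian_metric_def G_def rep elim!: U_cases)
      show "ip (G x) u u > 0" if "x \<in> U" "u \<noteq> 0" for x u
        using that g c by (auto simp: riemannian_metric_def G_def rep elim!: U_cases)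
      show "smooth_on U X"
        using xi c d by (simp add: unit_normal_field_def vector_field_along_def U_def X_def)
      show "ip (K (F x)) (fd F x u) (fd F x v) = ip (G x) u v" if "x \<in> U" for x u v
        using that phi c d by (auto simp: isometric_immersion_def K_def F_def G_def rep elim!: U_cases)
      show "ip (K (F x)) (X x) (X x) = 1" if "x \<in> U" for x
        using that xi c d by (auto simp: unit_normal_field_def K_def F_def X_def rep elim!: U_cases)
      show "ip (K (F x)) (X x) (fd F x u) = 0" if "x \<in> U" for x u
        using that xi c d by (auto simp: unit_normal_field_def K_def F_def X_def rep elim!: U_cases)
      show "Riem Kb y u v w = 0" if "y \<in> T" for y u v w
        using that flat d by (auto simp: flat_metric_def T_def Kb_def)
    qed (use T U codim smooth_K smooth_Kb smooth_s conf Kb in auto)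
    have x: "cmap c p \<in> U"
      using p by (auto simp: U_def)
    \<comment> \<open>The two coordinate expressions of \<sigma> on M agree on \<open>U\<close>,
      where the chart \<open>d\<close> can be inverted; as \<open>U\<close> is open, this suffices
      for the gradient.\<close>
    have "fd (rep c (\<sigma> \<circ> \<phi>)) (cmap c p) = fd (\<lambda>z. s (F z)) (cmap c p)"
      by (rule fd_cong[OF U x]) (auto simp: s_def F_def rep elim!: U_cases)
    then have "grad G (rep c (\<sigma> \<circ> \<phi>)) (cmap c p) = grad G (\<lambda>z. s (F z)) (cmap c p)"
      by (simp add: grad_def)
    moreover have "cmap d (\<phi> p) = F (cmap c p)"
      by (simp add: F_def rep p)
    ultimately show ?thesis
      using bitension_eq_0_iff[OF x]
      by (simp only: Let_def G_def[symmetric] K_def[symmetric] F_def[symmetric] X_def[symmetric] s_def[symmetric])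
  qed
  show ?thesis
    unfolding biharmonic_def using main by (simp only: cong: ball_cong imp_cong)
qed

end
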